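(* For every integer $k\ge1$, the set $$P_k=\{(x,y)\in[0,1]^2:\ 2x-1<y<2x,\ \ 2-4x<y<3-4x,\ \ \boldsymbol t_k<x<1-\boldsymbol t_k\}$$ is a dimension trap for the baker's map, i.e. $\dim_{\mathrm H}\mathcal J(P_k)=0$. Here $\boldsymbol t_k$ is the number with binary expansion $0.(t_0t_1\dots t_{2^k-1})^\infty$, where $t_0t_1t_2\dots$ is the Thue–Morse word.
   Context: The Thue–Morse word $t_0t_1t_2\dots=01101001\dots$ is given by $t_0=0$, $t_{2m}=t_m$, $t_{2m+1}=1-t_m$. Let $X=[0,1]^2$. The baker's map is $B(x,y)=(2x,\frac y2)$ if $0\le x<\frac12$ and $B(x,y)=(2x-1,\frac{y+1}2)$ if $\frac12\le x<1$. For a bi-infinite sequence $u=(x_n)_{n\in\mathbb Z}\in\{0,1\}^{\mathbb Z}$, written $\dots x_{-1}x_0\cdot x_1x_2\dots$, put $\pi(u)=\left(\sum_{n\ge1}x_n2^{-n},\ \sum_{n\ge0}x_{-n}2^{-n-1}\right)$. The map $\pi$ conjugates the left shift $\sigma$ and $B$; points and sequences are used interchangeably, so the $B$-orbit of the point $\pi(u)$ is $(\pi(\sigma^n u))_{n\in\mathbb Z}$. For $H\subset X$ the survivor set is $\mathcal J(H)=\{(x,y)\in X: B^n(x,y)\notin H \text{ for all } n\in\mathbb Z\}$, i.e. $\mathcal J(H)=\{\pi(u): \pi(\sigma^nu)\notin H\ \text{for all } n\in\mathbb Z\}$. An open set $H$ is a dimension trap if $\dim_{\mathrm H}\mathcal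 J(H)=0$ (Hausdorff dimension). *)

theory Defs
  imports "HOL-Analysis.Analysis"
begin

text \<open>
  Since \<open>0 powr 0 = 0\<close> and \<open>diameter {} = 0\<close> in the library, the usual conventions at \<open>s = 0\<close> (every
  nonempty set, in particular a point, has weight 1; the empty set has weight 0) are spelled out.
\<close>
definition diam_weight :: "real \<Rightarrow> 'a::metric_space set \<Rightarrow> ennreal" where
  "diam_weight s U =
     (if U = {} then 0 else if s = 0 then 1 else ennreal (diameter U powr s))"

text \<open>
  Boundedness is required explicitly because \<open>diameter\<close> is only meaningful for bounded sets. Finite
  covers are included, as members of the sequence may be empty.
\<close>
definition delta_covers :: "real \<Rightarrow> 'a::metric_space set \<Rightarrow> (nat \<Rightarrow> 'a set) set" where
  "delta_covers \<delta> A =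
     {U. A \<subseteq> (\<Union>i. U i) \<and> (\<forall>i. bounded (U i) \<and> diameter (U i) \<le> \<delta>)}"

definition hausdorff_premeasure :: "real \<Rightarrow> real \<Rightarrow> 'a::metric_space set \<Rightarrow> ennreal" where
  "hausdorff_premeasure s \<delta> A = (INF U\<in>delta_covers \<delta> A. \<Sum>i. diam_weight s (U i))"

definition hausdorff_measure :: "real \<Rightarrow> 'a::metric_space set \<Rightarrow> ennreal" where
  "hausdorff_measure s A = (SUP \<delta>\<in>{0<..}. hausdorff_premeasure s \<delta> A)"

definition hausdorff_dim :: "'a::metric_space set \<Rightarrow> ennreal" where
  "hausdorff_dim A = Inf {ennreal s | s. 0 \<le> s \<and> hausdorff_measure s A = 0}"

definition unit_square :: "(real \<times> real) set" where
  "unit_square = {0..1} \<times> {0..1}"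

text \<open>Only meaningful for \<open>0 \<le> x < 1\<close>.\<close>
definition baker :: "real \<times> real \<Rightarrow> real \<times> real" where
  "baker = (\<lambda>(x, y). if x < 1/2 then (2 * x, y / 2) else (2 * x - 1, (y + 1) / 2))"

definition binary_seqs :: "(int \<Rightarrow> nat) set" where
  "binary_seqs = {u. \<forall>n. u n \<in> {0, 1}}"

text \<open>\<open>shift n\<close> is the \<open>n\<close>-th power of the left shift, for every integer \<open>n\<close>.\<close>
definition shift :: "int \<Rightarrow> (int \<Rightarrow> nat) \<Rightarrow> (int \<Rightarrow> nat)" where
  "shift n u = (\<lambda>m. u (m + n))"

definition coding :: "(int \<Rightarrow> nat) \<Rightarrow> real \<times> real" where
  "coding u = ((\<Sum>n. real (u (int n + 1)) / 2 ^ (n + 1)), (\<Sum>n. real (u (- int n)) / 2 ^ (n + 1)))"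

text \<open>
  The two-sided orbit of a point under the baker's map is read off from a sequence coding it, which
  makes it total, also where \<open>baker\<close> is undefined (\<open>x = 1\<close>). The link with \<open>baker\<close> itself is the
  lemma \<open>coding_shift\<close> below. A point with several codings (one with a dyadic rational coordinate)
  survives as soon as one of its codings does.
\<close>
definition survivor_set :: "(real \<times> real) set \<Rightarrow> (real \<times> real) set" where
  "survivor_set H = {coding u | u. u \<in> binary_seqs \<and> (\<forall>n. coding (shift n u) \<notin> H)}"

text \<open>Open means open in the phase space, the closed unit square.\<close>
definition dimension_trap :: "(real \<times> real) set \<Rightarrow> bool" where
  "dimension_trap H \<longleftrightarrow>
     openin (top_of_set unit_square) H \<and> hausdorff_dim (survivor_set H) = 0"

fun thue_morse :: "nat \<Rightarrow> nat" where
  "thue_morse n =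
     (if n = 0 then 0
      else if even n then thue_morse (n div 2)
      else 1 - thue_morse (n div 2))"

declare thue_morse.simps [simp del]

definition thue_morse_number :: "nat \<Rightarrow> real" where
  "thue_morse_number k = (\<Sum>n. real (thue_morse (n mod 2 ^ k)) / 2 ^ (n + 1))"

definition trap_region :: "nat \<Rightarrow> (real \<times> real) set" where
  "trap_region k =
     {(x, y) \<in> unit_square.
        2 * x - 1 < y \<and> y < 2 * x \<and>
        2 - 4 * x < y \<and> y < 3 - 4 * x \<and>
        thue_morse_number k < x \<and> x < 1 - thue_morse_number k}"

lemma thue_morse_rec:
  "thue_morse 0 = 0"
  "thue_morse (2 * m) = thue_morse m"
  "thue_morse (2 * m + 1) = 1 - thue_morse m"
  by (simp_all add: thue_morse.simps[of 0] thue_morse.simps[of "2 * m"]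
        thue_morse.simps[of "Suc (2 * m)"])

lemma thue_morse_binary: "thue_morse n \<in> {0, 1}"
proof (induction n rule: less_induct)
  case (less n)
  then show ?case
    using less[of "n div 2"] by (cases "n = 0") (auto simp: thue_morse.simps[of n] thue_morse_rec(1))
qed

lemma summable_digits:
  assumes "\<And>n. a n \<in> {0, 1::nat}"
  shows "summable (\<lambda>n. real (a n) / 2 ^ (n + 1))"
proof (rule summable_comparison_test')
  show "summable (\<lambda>n. (1/2::real) ^ n)"
    by (rule summable_geometric) simp
  show "norm (real (a n) / 2 ^ (n + 1)) \<le> (1/2) ^ n" if "n \<ge> 0" for n
    using assms[of n] by (auto simp: power_divide field_simps)
qed

lemma suminf_digits_split:
  assumes "\<And>n. a n \<in> {0, 1::nat}"
  shows "(\<Sum>n. real (a n) / 2 ^ (n + 1)) =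
         (real (a 0) + (\<Sum>n. real (a (Suc n)) / 2 ^ (n + 1))) / 2"
proof -
  have s: "summable (\<lambda>n. real (a (Suc n)) / 2 ^ (n + 1))"
    by (rule summable_digits) (rule assms)
  have "(\<Sum>n. real (a (Suc n)) / 2 ^ (Suc n + 1)) = (\<Sum>n. (real (a (Suc n)) / 2 ^ (n + 1)) / 2)"
    by (simp add: field_simps)
  also have "\<dots> = (\<Sum>n. real (a (Suc n)) / 2 ^ (n + 1)) / 2"
    by (rule suminf_divide[OF s])
  finally show ?thesis
    using suminf_split_head[OF summable_digits[of a, OF assms]]
    by (simp add: add_divide_distrib)
qed

lemma suminf_digits_less_1:
  assumes a: "\<And>n. a n \<in> {0, 1::nat}" and k: "a k = 0"
  shows "(\<Sum>n. real (a n) / 2 ^ (n + 1)) < 1"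
proof -
  have s1: "summable (\<lambda>n. 1 / 2 ^ (n + 1) :: real)"
    using summable_digits[of "\<lambda>_. 1"] by simp
  have one: "(\<Sum>n. 1 / 2 ^ (n + 1) :: real) = 1"
    using suminf_digits_split[of "\<lambda>_. 1"] by simp
  let ?d = "\<lambda>n. 1 / 2 ^ (n + 1) - real (a n) / 2 ^ (n + 1) :: real"
  have "0 < suminf ?d"
  proof (rule suminf_pos2[where i = k])
    show "summable ?d"
      by (rule summable_diff[OF s1 summable_digits[of a, OF a]])
    show "0 \<le> ?d n" for n
      using a[of n] by auto
    show "0 < ?d k"
      by (simp add: k)
  qed
  also have "suminf ?d = 1 - (\<Sum>n. real (a n) / 2 ^ (n + 1))"
    using suminf_diff[OF s1 summable_digits[of a, OF a]] one by simp
  finally show ?thesis by simp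
qed

text \<open>
  The side condition excludes the expansions \<open>x = 0.0111\<dots>\<close> of \<open>1/2\<close> and \<open>x = 0.111\<dots>\<close> of \<open>1\<close>, for which
  the two sides differ.
\<close>
lemma coding_shift:
  assumes u: "u \<in> binary_seqs" and k: "k \<ge> 2" "u k = 0"
  shows "coding (shift 1 u) = baker (coding u)"
proof -
  have b: "u n \<in> {0, 1}" for n
    using u by (auto simp: binary_seqs_def)
  define x where "x = (\<Sum>n. real (u (int n + 2)) / 2 ^ (n + 1))"
  define y where "y = (\<Sum>n. real (u (- int n)) / 2 ^ (n + 1))"
  have x0: "0 \<le> x"
    unfolding x_def by (intro suminf_nonneg summable_digits b) auto
  have x1: "x < 1"
    unfolding x_def by (rule suminf_digits_less_1[of _ "nat (k - 2)"]) (use b k in auto)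
  have c: "coding u = ((real (u 1) + x) / 2, y)"
    using suminf_digits_split[of "\<lambda>n. u (int n + 1)"] b
    by (simp add: coding_def x_def y_def add.commute)
  have d: "coding (shift 1 u) = (x, (real (u 1) + y) / 2)"
    using suminf_digits_split[of "\<lambda>n. u (1 - int n)"] b
    by (simp add: coding_def shift_def x_def y_def add.commute)
  show ?thesis
    using b[of 1] x0 x1 by (auto simp: c d baker_def field_simps)
qed

end

theory Submission
  imports Defs
begin

text \<open>
  Encode a sequence by its digit changes. The lexicographic order turns into the order \<open>ugt\<close> of unimodal
  maps, the Thue--Morse substitution into the period doubling substitution \<open>1 \<mapsto> 10, 0 \<mapsto> 11\<close>, and the
  inequalities defining \<open>P\<^sub>k\<close> become comparisons of the past with the future, and of the future with
  a periodic word. Equality between different expansions only occurs if both ends of the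
  sequence are eventually constant, which accounts for countably many points.

  Write a word of digit changes that avoids \<open>P\<^sub>k\<close> as a sequence of runs of \<open>1\<close>s separated by single \<open>0\<close>s.
  After the last run of even length all runs are odd, so this part is the image under period doubling
  of a word that avoids \<open>P\<^sub>k\<^sub>-\<^sub>1\<close>. Before it, the comparisons of past and future force
  the word to be a product of powers of words taken in a fixed order, with boundedly many words
  of each length. So the number of these words grows like a number of partitions, and by
  induction on \<open>k\<close> the number of all words of length \<open>n\<close> is subexponential in \<open>n\<close>.
\<close>

section \<open>Admissible words of digit changes\<close>

text \<open>
  The order of binary expansions with a common first digit \<open>0\<close>, read off from the lists of digit changes:
  the roles of the two lists are swapped after each common change. \<open>ugt as bs\<close> says that the
  comparison is already decided by the two finite lists, with \<open>as\<close> the larger one.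
\<close>
function ugt :: "bool list \<Rightarrow> bool list \<Rightarrow> bool" where
  "ugt (a # as) (b # bs) = (if a = b then (if a then ugt bs as else ugt as bs) else a)"
| "ugt [] bs = False"
| "ugt (a # as) [] = False"
  by pat_completeness auto
termination by (relation "Wellfounded.measure (\<lambda>(as, bs). length as + length bs)") auto

lemma ugt_append: "ugt as bs \<Longrightarrow> ugt (as @ cs) (bs @ ds)"
  by (induction as bs arbitrary: cs ds rule: ugt.induct) (auto split: if_splits)

lemma ugt_replicate_False [simp]:
  "ugt (replicate q False @ as) (replicate q False @ bs) = ugt as bs"
  by (induction q) auto

text \<open>Two common changes swap the roles twice, so pairs of \<open>True\<close> cancel. Either
  the even run is used up first, or the odd run shrinks to length one and a single swap puts the
  rest of the even run in front.\<close>

lemma ugt_run: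
  assumes "even c" "odd p \<or> c < p"
  shows "ugt (replicate p True @ False # as) (replicate c True @ False # bs)"
  using assms
proof (induction c arbitrary: p rule: less_induct)
  case (less c)
  consider "c = 0" | "c \<noteq> 0" "p = 1" | "c \<noteq> 0" "p \<ge> 2"
    using less.prems by (cases "p = 0"; cases "p = 1") auto
  then show ?case
  proof cases
    case 1
    with less.prems show ?thesis by (cases p) auto
  next
    case 2
    then obtain c' where "c = Suc (Suc c')"
      using less.prems(1) by (metis even_Suc even_zero not0_implies_Suc)
    with 2 show ?thesis by simp
  next
    case 3
    then obtain c' p' where cp: "c = Suc (Suc c')" "p = Suc (Suc p')"
      using less.prems(1)
      by (metis even_Suc even_zero not0_implies_Suc add_2_eq_Suc le_Suc_ex)
    then have "ugt (replicate p' True @ False # as) (replicate c' True @ False # bs)"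
      using less.prems by (intro less.IH) auto
    with cp show ?thesis by simp
  qed
qed

text \<open>The Thue--Morse substitution \<open>0 \<mapsto> 01, 1 \<mapsto> 10\<close>, acting on digit changes.\<close>
fun pd :: "bool list \<Rightarrow> bool list" where
  "pd [] = []"
| "pd (a # as) = True # (\<not> a) # pd as"

lemma pd_append [simp]: "pd (as @ bs) = pd as @ pd bs"
  by (induction as) auto

lemma length_pd [simp]: "length (pd as) = 2 * length as"
  by (induction as) auto

lemma inj_pd: "inj pd"
proof (rule injI)
  fix as bs assume "pd as = pd bs"
  then show "as = bs"
  proof (induction as arbitrary: bs)
    case Nil then show ?case by (cases bs) auto
  next
    case (Cons a as) then show ?case by (cases bs) auto
  qed
qed

text \<open>Every second letter of \<open>pd as\<close> is \<open>True\<close>, so reversal only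
  shifts the blocks by one letter. This is needed because a past is read backwards.\<close>

lemma True_rev_pd: "True # rev (pd as) = pd (rev as) @ [True]"
proof (induction as)
  case (Cons a as)
  have "True # rev (pd (a # as)) = (True # rev (pd as)) @ [\<not> a, True]"
    by simp
  then show ?case unfolding Cons.IH by simp
qed simp

text \<open>The negated letters keep the count of swaps right: a common \<open>False\<close> becomes
  two swaps, a common \<open>True\<close> becomes one, and a difference is negated after a single
  swap.\<close>

lemma ugt_pd: "ugt as bs \<Longrightarrow> ugt (pd as) (pd bs)"
  by (induction as bs rule: ugt.induct) (auto split: if_splits)

text \<open>These turn out to be the prefixes of the digit changes of the periodic Thue--Morse
  words; at level 0 the sequence is constant and never changes.\<close>

primrec pdword :: "nat \<Rightarrow> nat \<Rightarrow> bool list" where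
  "pdword 0 n = replicate n False"
| "pdword (Suc k) n = pd (pdword k n)"

lemma length_pdword [simp]: "length (pdword k n) = 2 ^ k * n"
  by (induction k) auto

text \<open>
  The expansion with digit changes \<open>10s\<close> is not yet known to exceed that of \<open>thue_morse_number k\<close>.
\<close>
definition low :: "nat \<Rightarrow> bool list \<Rightarrow> bool" where
  "low k s \<longleftrightarrow> (\<forall>n. \<not> ugt (True # False # s) (pdword k n))"

lemma low_appendD: "low k (s @ t) \<Longrightarrow> low k s"
  unfolding low_def using ugt_append[of "True # False # s" _ t "[]"] by auto

lemma not_low_0: "\<not> low 0 s"
  unfolding low_def by (auto intro!: exI[of _ 1])

text \<open>\<open>True # False # True # True # pd s\<close> is
  \<open>pd (True # False # s)\<close>, so \<open>ugt_pd\<close> carries a violation at level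
  \<open>k\<close> to level \<open>Suc k\<close>.\<close>

lemma low_pd: "low (Suc k) (True # True # pd s) \<Longrightarrow> low k s"
  unfolding low_def using ugt_pd[of "True # False # s"] by auto

text \<open>Counting from 0, \<open>pd v\<close> has \<open>True\<close> at every even index. A
  first departure from the run of \<open>True\<close>s is at an odd index, with the roles swapped,
  and makes \<open>pd v\<close> larger; otherwise it still has a \<open>True\<close> where the run
  ends, with the roles restored.\<close>

lemma ugt_pd_run:
  "j < length v \<Longrightarrow> ugt (pd v) (replicate (2 * j) True @ False # s)"
proof (induction j arbitrary: v)
  case 0
  then show ?case by (cases v) auto
next
  case (Suc j)
  then obtain a v' where "v = a # v'" by (cases v) auto
  with Suc show ?case by (cases a) auto
qed

text \<open>A bound starting with \<open>True # True\<close> is exceeded at once. If it starts with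
  \<open>True # False\<close>, the common prefix leaves one swap, and \<open>ugt_pd_run\<close>
  decides the rest.\<close>

lemma not_low_even_run:
  assumes "even c"
  shows "\<not> low k (replicate c True @ False # s)"
proof (cases k)
  case 0
  then show ?thesis by (simp add: not_low_0)
next
  case (Suc k')
  obtain j where j: "c = 2 * j" using assms by auto
  \<comment> \<open>One block of the bound is matched by \<open>True # False\<close>, and
    \<open>ugt_pd_run\<close> needs more than \<open>j\<close> further ones.\<close>
  define v where "v = pdword k' (j + 2)"
  have "1 * (j + 2) \<le> 2 ^ k' * (j + 2)" by (intro mult_right_mono) auto
  then have len: "j + 2 \<le> length v" by (simp add: v_def)
  then obtain a v' where v: "v = a # v'" by (cases v) auto
  have "ugt (pd v') (replicate c True @ False # s)"
    unfolding j using len v by (intro ugt_pd_run) auto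
  then have "ugt (True # False # replicate c True @ False # s) (pd v)"
    unfolding v by (cases a) auto
  then show ?thesis unfolding low_def Suc pdword.simps v_def by blast
qed

lemma not_low_False: "\<not> low k (False # s)"
  using not_low_even_run[of 0] by simp

text \<open>
  At each factor \<open>10\<close>, let \<open>x\<close> be the number with digit changes \<open>10s\<close>. By symmetry its first digit
  may be taken to be \<open>0\<close>. If the run of \<open>1\<close>s has length at most 2, then \<open>y \<ge> 2 x \<or> y \<le> 2 - 4 x\<close> amounts to
  \<open>\<not> ugt (rev p) s\<close>; for longer runs it is impossible. The other inequalities on \<open>y\<close> then hold
  automatically.
\<close>
definition admissible :: "nat \<Rightarrow> bool list \<Rightarrow> bool" where
  "admissible k w \<longleftrightarrow>
     (\<forall>p s. w = p @ [False, True, False] @ s \<longrightarrow> low k s \<or> \<not> ugt (rev p) s) \<and>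
     (\<forall>p s. w = p @ [False, True, True, False] @ s \<longrightarrow> low k s \<or> \<not> ugt (rev p) s) \<and>
     (\<forall>p s. w = p @ [True, True, True, False] @ s \<longrightarrow> low k s)"

lemma admissibleD:
  assumes "admissible k w"
  shows "w = p @ [False, True, False] @ s \<Longrightarrow> \<not> low k s \<Longrightarrow> \<not> ugt (rev p) s"
    and "w = p @ [False, True, True, False] @ s \<Longrightarrow> \<not> low k s \<Longrightarrow> \<not> ugt (rev p) s"
    and "w = p @ [True, True, True, False] @ s \<Longrightarrow> low k s"
  using assms unfolding admissible_def by blast+

text \<open>A comparison decided inside a factor stays decided under extension, so violations are
  inherited by longer words.\<close>

lemma admissible_factor:
  assumes "admissible k (xs @ w @ ys)"
  shows "admissible k w"
  unfolding admissible_def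
proof (intro conjI allI impI)
  fix p s
  {
    assume "w = p @ [False, True, False] @ s"
    then have "xs @ w @ ys = (xs @ p) @ [False, True, False] @ (s @ ys)" by simp
    then have "low k (s @ ys) \<or> \<not> ugt (rev (xs @ p)) (s @ ys)"
      using admissibleD(1)[OF assms] by blast
    then show "low k s \<or> \<not> ugt (rev p) s"
      using low_appendD ugt_append[of "rev p" s "rev xs" ys] by auto
  next
    assume "w = p @ [False, True, True, False] @ s"
    then have "xs @ w @ ys = (xs @ p) @ [False, True, True, False] @ (s @ ys)" by simp
    then have "low k (s @ ys) \<or> \<not> ugt (rev (xs @ p)) (s @ ys)"
      using admissibleD(2)[OF assms] by blast
    then show "low k s \<or> \<not> ugt (rev p) s"
      using low_appendD ugt_append[of "rev p" s "rev xs" ys] by auto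
  next
    assume "w = p @ [True, True, True, False] @ s"
    then have "xs @ w @ ys = (xs @ p) @ [True, True, True, False] @ (s @ ys)" by simp
    then have "low k (s @ ys)"
      by (rule admissibleD(3)[OF assms])
    then show "low k s" by (rule low_appendD)
  }
qed

text \<open>Each pattern of \<open>w\<close> yields a pattern of \<open>pd w\<close>. A run of one
  turns into three or more \<open>True\<close>s, where \<open>low\<close> is forced; a run of two
  yields a run of one with the same comparison; a longer run yields a run of one whose comparison
  always holds.\<close>

lemma admissible_pdD:
  assumes "admissible (Suc k) (pd w)"
  shows "admissible k w"
  unfolding admissible_def
proof (intro conjI allI impI)
  fix p s
  {
    assume "w = p @ [False, True, False] @ s"
    then have "pd w = pd p @ [True, True, True, False] @ (True # True # pd s)" by simp
    then have "low (Suc k) (True # True # pd s)"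
      by (rule admissibleD(3)[OF assms])
    then show "low k s \<or> \<not> ugt (rev p) s" using low_pd by blast
  next
    assume "w = p @ [False, True, True, False] @ s"
    then have "pd w = (pd p @ [True, True, True]) @ [False, True, False] @ (True # True # pd s)"
      by simp
    then have "low (Suc k) (True # True # pd s) \<or>
        \<not> ugt (rev (pd p @ [True, True, True])) (True # True # pd s)"
      using admissibleD(1)[OF assms] by blast
    \<comment> \<open>Two common \<open>True\<close>s cancel; the third completes
      \<open>rev (pd p)\<close> to a doubled word.\<close>
    then have "low k s \<or> \<not> ugt (pd (rev p) @ [True]) (pd s)"
      by (auto simp: True_rev_pd[symmetric] dest: low_pd)
    then show "low k s \<or> \<not> ugt (rev p) s"
      using ugt_append[OF ugt_pd, of "rev p" s "[True]" "[]"] by auto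
  next
    assume "w = p @ [True, True, True, False] @ s"
    then have "pd w = (pd p @ [True, False, True]) @ [False, True, False] @ (True # True # pd s)"
      by simp
    then have "low (Suc k) (True # True # pd s) \<or>
        \<not> ugt (rev (pd p @ [True, False, True])) (True # True # pd s)"
      using admissibleD(1)[OF assms] by blast
    then show "low k s" by (auto dest: low_pd)
  }
qed

section \<open>Languages of subexponential growth\<close>

text \<open>A generating function evaluated at \<open>x\<close>: bounding all finite partial sums
  gives convergence and a bound on the sum together.\<close>

definition gf_bound :: "real \<Rightarrow> real \<Rightarrow> 'a list set \<Rightarrow> bool" where
  "gf_bound x B L \<longleftrightarrow> (\<forall>F. finite F \<longrightarrow> F \<subseteq> L \<longrightarrow> (\<Sum>w\<in>F. x ^ length w) \<le> B)"

text \<open>Radius of convergence at least one: for each positive \<open>x < 1\<close>, the number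
  of words of length n is at most a constant times x^(-n).\<close>

definition subexponential :: "'a list set \<Rightarrow> bool" where
  "subexponential L \<longleftrightarrow> (\<forall>x. 0 < x \<longrightarrow> x < 1 \<longrightarrow> (\<exists>B. gf_bound x B L))"

definition conc :: "'a list set \<Rightarrow> 'a list set \<Rightarrow> 'a list set" where
  "conc A B = {a @ b |a b. a \<in> A \<and> b \<in> B}"

definition star :: "'a list \<Rightarrow> 'a list set" where
  "star v = range (\<lambda>n. concat (replicate n v))"

primrec star_prod :: "'a list list \<Rightarrow> 'a list set" where
  "star_prod [] = {[]}"
| "star_prod (v # vs) = conc (star v) (star_prod vs)"

lemma concI: "a \<in> A \<Longrightarrow> b \<in> B \<Longrightarrow> a @ b \<in> conc A B"
  by (auto simp: conc_def)

lemma starI: "concat (replicate n v) \<in> star v"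
  by (auto simp: star_def)

lemma Nil_star: "[] \<in> star v"
  using starI[of 0] by simp

lemma replicate_star: "replicate n a \<in> star [a]"
proof -
  have "concat (replicate n [a]) = replicate n a" by (induction n) auto
  then show ?thesis using starI[of n "[a]"] by simp
qed

lemma conc_assoc: "conc (conc A B) C = conc A (conc B C)"
proof (intro set_eqI iffI)
  fix w
  show "w \<in> conc A (conc B C)" if "w \<in> conc (conc A B) C"
    using that unfolding conc_def by clarsimp (metis append_assoc)
  show "w \<in> conc (conc A B) C" if "w \<in> conc A (conc B C)"
    using that unfolding conc_def by clarsimp (metis append_assoc)
qed

lemma conc_Nil [simp]: "conc {[]} A = A"
  by (auto simp: conc_def)

lemma star_prod_append: "star_prod (us @ vs) = conc (star_prod us) (star_prod vs)"
  by (induction us) (simp_all add: conc_assoc)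

lemma Nil_star_prod: "[] \<in> star_prod vs"
  by (induction vs) (use concI[OF Nil_star] in auto)

lemma gf_bound_mono: "gf_bound x B L \<Longrightarrow> L' \<subseteq> L \<Longrightarrow> B \<le> B' \<Longrightarrow> gf_bound x B' L'"
  unfolding gf_bound_def by (meson order_trans)

lemma gf_bound_nonneg: "gf_bound x B L \<Longrightarrow> 0 \<le> B"
  unfolding gf_bound_def by (metis empty_subsetI finite.emptyI sum.empty)

lemma gf_bound_Un:
  assumes "0 < x" "gf_bound x B L" "gf_bound x B' L'"
  shows "gf_bound x (B + B') (L \<union> L')"
  unfolding gf_bound_def
proof (intro allI impI)
  fix F assume F: "finite F" "F \<subseteq> L \<union> L'"
  have "(\<Sum>w\<in>F. x ^ length w) = (\<Sum>w\<in>F \<inter> L. x ^ length w) + (\<Sum>w\<in>F - L. x ^ length w)"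
    using F sum.Int_Diff[of F "\<lambda>w. x ^ length w" L] by simp
  also have "\<dots> \<le> B + B'"
  proof (rule add_mono)
    show "(\<Sum>w\<in>F \<inter> L. x ^ length w) \<le> B"
      using assms(2) F(1) unfolding gf_bound_def by simp
    have "F - L \<subseteq> L'" using F(2) by blast
    then show "(\<Sum>w\<in>F - L. x ^ length w) \<le> B'"
      using assms(3) F(1) unfolding gf_bound_def by simp
  qed
  finally show "(\<Sum>w\<in>F. x ^ length w) \<le> B + B'" .
qed

lemma gf_bound_image:
  assumes "0 < x" "gf_bound (x ^ m) B L" "\<And>w. length (f w) = m * length w" "inj f"
  shows "gf_bound x B (f ` L)"
  unfolding gf_bound_def
proof (intro allI impI)
  fix F assume F: "finite F" "F \<subseteq> f ` L"
  then obtain G where G: "G \<subseteq> L" "finite G" "F = f ` G"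
    by (meson finite_subset_image)
  have "(\<Sum>w\<in>F. x ^ length w) = (\<Sum>w\<in>G. (x ^ m) ^ length w)"
    unfolding G(3) using assms(3) inj_on_subset[OF assms(4)]
    by (subst sum.reindex) (auto simp: power_mult)
  then show "(\<Sum>w\<in>F. x ^ length w) \<le> B"
    using assms(2) G unfolding gf_bound_def by auto
qed

lemma gf_bound_conc:
  assumes "0 < x" "gf_bound x B L" "gf_bound x B' L'"
  shows "gf_bound x (B * B') (conc L L')"
  unfolding gf_bound_def
proof (intro allI impI)
  fix F assume F: "finite F" "F \<subseteq> conc L L'"
  have "\<forall>w\<in>F. \<exists>p. w = fst p @ snd p \<and> fst p \<in> L \<and> snd p \<in> L'"
  proof
    fix w assume "w \<in> F"
    then obtain a b where "w = a @ b" "a \<in> L" "b \<in> L'" using F(2) unfolding conc_def by blast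
    then show "\<exists>p. w = fst p @ snd p \<and> fst p \<in> L \<and> snd p \<in> L'"
      by (intro exI[of _ "(a, b)"]) simp
  qed
  \<comment> \<open>A word may factor in several ways. Choosing one factorization makes the map to
    pairs injective, which suffices for an upper bound.\<close>
  then obtain g where g: "\<And>w. w \<in> F \<Longrightarrow> w = fst (g w) @ snd (g w) \<and> fst (g w) \<in> L \<and> snd (g w) \<in> L'"
    by metis
  define G where "G = (fst \<circ> g) ` F"
  define H where "H = (snd \<circ> g) ` F"
  have "inj_on g F" by (rule inj_onI) (metis g)
  moreover have "x ^ length w = x ^ length (fst (g w)) * x ^ length (snd (g w))" if "w \<in> F" for w
    using g[OF that] by (metis length_append power_add)
  ultimately have "(\<Sum>w\<in>F. x ^ length w) = (\<Sum>p\<in>g ` F. x ^ length (fst p) * x ^ length (snd p))"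
    by (simp add: sum.reindex)
  also have "\<dots> \<le> (\<Sum>p\<in>G \<times> H. x ^ length (fst p) * x ^ length (snd p))"
  proof (intro sum_mono2)
    show "finite (G \<times> H)" using F by (auto simp: G_def H_def)
    show "g ` F \<subseteq> G \<times> H" unfolding G_def H_def by (rule image_subsetI) (simp add: mem_Times_iff)
  qed (use assms(1) in auto)
  also have "\<dots> = (\<Sum>a\<in>G. x ^ length a) * (\<Sum>b\<in>H. x ^ length b)"
    by (simp add: sum_product sum.cartesian_product case_prod_beta)
  also have "\<dots> \<le> B * B'"
  proof (rule mult_mono)
    have "finite G" "G \<subseteq> L" "finite H" "H \<subseteq> L'" using F g by (auto simp: G_def H_def)
    then show "(\<Sum>a\<in>G. x ^ length a) \<le> B" "(\<Sum>b\<in>H. x ^ length b) \<le> B'"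
      using assms(2,3) unfolding gf_bound_def by simp_all
  qed (use assms(1) gf_bound_nonneg[OF assms(2)] in \<open>auto intro!: sum_nonneg\<close>)
  finally show "(\<Sum>w\<in>F. x ^ length w) \<le> B * B'" .
qed

lemma gf_bound_star:
  assumes "0 < x" "x < 1" "v \<noteq> []"
  shows "gf_bound x (1 / (1 - x ^ length v)) (star v)"
  unfolding gf_bound_def
proof (intro allI impI)
  fix F assume F: "finite F" "F \<subseteq> star v"
  define y where "y = x ^ length v"
  have y: "0 < y" "y < 1" using assms by (auto simp: y_def power_less_one_iff)
  obtain N where N: "finite N" "F = (\<lambda>n. concat (replicate n v)) ` N"
    using F unfolding star_def by (meson finite_subset_image)
  have len: "length (concat (replicate n v)) = length v * n" for n
    by (induction n) auto
  have "inj (\<lambda>n. concat (replicate n v))"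
  proof (rule injI)
    fix m n assume "concat (replicate m v) = concat (replicate n v)"
    from arg_cong[OF this, of length] show "m = n" using assms(3) by (simp add: len)
  qed
  then have "(\<Sum>w\<in>F. x ^ length w) = (\<Sum>n\<in>N. y ^ n)"
    unfolding N(2) y_def by (subst sum.reindex) (auto simp: len power_mult intro: inj_on_subset)
  also have "\<dots> \<le> (\<Sum>n. y ^ n)"
    using y N by (intro sum_le_suminf) (auto intro: summable_geometric)
  also have "\<dots> = 1 / (1 - y)" using y by (subst suminf_geometric) auto
  finally show "(\<Sum>w\<in>F. x ^ length w) \<le> 1 / (1 - x ^ length v)" by (simp add: y_def)
qed

text \<open>As for partitions, factors 1/(1 - y) with y = x^|v| multiply. Since y \<le> x, each is
  at most exp(y/(1 - x)), so the bound depends on the sum of the y and not on the number of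
  factors.\<close>

lemma gf_bound_star_prod:
  assumes x: "0 < x" "x < 1" and vs: "[] \<notin> set vs"
  shows "gf_bound x (exp ((\<Sum>v\<leftarrow>vs. x ^ length v) / (1 - x))) (star_prod vs)"
  using vs
proof (induction vs)
  case Nil
  have "(\<Sum>w\<in>F. x ^ length w) \<le> 1" if "F \<subseteq> {[]}" for F :: "'a list set"
    using subset_singletonD[OF that] by auto
  then show ?case by (auto simp: gf_bound_def)
next
  case (Cons v vs)
  define y where "y = x ^ length v"
  have y: "0 < y" "y < 1" "y \<le> x"
    using x Cons.prems power_decreasing[of 1 "length v" x]
    by (auto simp: y_def power_less_one_iff Suc_le_eq)
  have "1 / (1 - y) = 1 + y / (1 - y)" using y by (simp add: field_simps)
  also have "\<dots> \<le> exp (y / (1 - y))" by (rule exp_ge_add_one_self)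
  also have "\<dots> \<le> exp (y / (1 - x))" using y x by (simp add: frac_le)
  finally have le: "1 / (1 - y) \<le> exp (y / (1 - x))" .
  have "gf_bound x (1 / (1 - y) * exp ((\<Sum>v\<leftarrow>vs. x ^ length v) / (1 - x))) (star_prod (v # vs))"
    unfolding y_def star_prod.simps using x Cons by (intro gf_bound_conc gf_bound_star) auto
  moreover have "1 / (1 - y) * exp ((\<Sum>v\<leftarrow>vs. x ^ length v) / (1 - x))
      \<le> exp ((\<Sum>v\<leftarrow>v # vs. x ^ length v) / (1 - x))"
    using mult_right_mono[OF le, of "exp ((\<Sum>v\<leftarrow>vs. x ^ length v) / (1 - x))"]
    by (simp add: y_def add_divide_distrib exp_add)
  ultimately show ?case by (rule gf_bound_mono[OF _ order_refl])
qed

lemma gf_bound_UN: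
  assumes "\<And>N. gf_bound x B (L N)" "\<And>M N :: nat. M \<le> N \<Longrightarrow> L M \<subseteq> L N"
  shows "gf_bound x B (\<Union>N. L N)"
  unfolding gf_bound_def
proof (intro allI impI)
  fix F assume F: "finite F" "F \<subseteq> (\<Union>N. L N)"
  then have "\<forall>w\<in>F. \<exists>n. w \<in> L n" by auto
  then obtain g where g: "\<And>w. w \<in> F \<Longrightarrow> w \<in> L (g w)" by metis
  have "g w \<le> Max (insert 0 (g ` F))" if "w \<in> F" for w using F that by auto
  then have "F \<subseteq> L (Max (insert 0 (g ` F)))" using g assms(2) by blast
  then show "(\<Sum>w\<in>F. x ^ length w) \<le> B" using assms(1) F unfolding gf_bound_def by blast
qed

lemma subexponential_subset: "subexponential L \<Longrightarrow> L' \<subseteq> L \<Longrightarrow> subexponential L'"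
  unfolding subexponential_def using gf_bound_mono by (metis order_refl)

lemma subexponential_Un: "subexponential L \<Longrightarrow> subexponential L' \<Longrightarrow> subexponential (L \<union> L')"
  unfolding subexponential_def using gf_bound_Un by metis

lemma subexponential_conc: "subexponential L \<Longrightarrow> subexponential L' \<Longrightarrow> subexponential (conc L L')"
  unfolding subexponential_def using gf_bound_conc by metis

lemma subexponential_star: "v \<noteq> [] \<Longrightarrow> subexponential (star v)"
  unfolding subexponential_def using gf_bound_star by metis

lemma subexponential_single: "subexponential {w}"
  unfolding subexponential_def
proof (intro allI impI exI)
  fix x :: real
  assume x: "0 < x"
  have "(\<Sum>w\<in>F. x ^ length w) \<le> x ^ length w" if "F \<subseteq> {w}" for F
    using subset_singletonD[OF that] x by auto
  then show "gf_bound x (x ^ length w) {w}" by (auto simp: gf_bound_def)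
qed

lemma subexponential_pd: "subexponential L \<Longrightarrow> subexponential (pd ` L)"
  unfolding subexponential_def
proof (intro allI impI)
  fix x :: real
  assume *: "\<forall>x. 0 < x \<longrightarrow> x < 1 \<longrightarrow> (\<exists>B. gf_bound x B L)" and x: "0 < x" "x < 1"
  then have "0 < x ^ 2" "x ^ 2 < 1" by (auto simp: power_less_one_iff)
  then obtain B where "gf_bound (x ^ 2) B L" using * by blast
  then have "gf_bound x B (pd ` L)"
    using x by (intro gf_bound_image inj_pd) auto
  then show "\<exists>B. gf_bound x B (pd ` L)" ..
qed

lemma sum_powers_le:
  fixes x :: real
  assumes "0 < x" "x < 1"
  shows "(\<Sum>i<N. x ^ i) \<le> 1 / (1 - x)"
proof -
  have "(\<Sum>i<N. x ^ i) \<le> (\<Sum>i. x ^ i)"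
    using assms by (intro sum_le_suminf) (auto intro: summable_geometric)
  also have "\<dots> = 1 / (1 - x)" using assms by (subst suminf_geometric) auto
  finally show ?thesis .
qed

text \<open>At most \<open>C\<close> words are charged to each power of \<open>x\<close>, so the
  exponent in \<open>gf_bound_star_prod\<close> is bounded uniformly in the cutoff
  \<open>N\<close>.\<close>

lemma subexponential_star_prod_UN:
  fixes C :: real
  assumes ne: "\<And>N. [] \<notin> set (vs N)"
    and mono: "\<And>N. star_prod (vs N) \<subseteq> star_prod (vs (Suc N))"
    and le: "\<And>x N. 0 < x \<Longrightarrow> (x::real) < 1 \<Longrightarrow> (\<Sum>v\<leftarrow>vs N. x ^ length v) \<le> C * (\<Sum>i<N. x ^ i)"
    and C: "0 \<le> C"
  shows "subexponential (\<Union>N. star_prod (vs N))"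
  unfolding subexponential_def
proof (intro allI impI exI)
  fix x :: real assume x: "0 < x" "x < 1"
  show "gf_bound x (exp (C * (1 / (1 - x)) / (1 - x))) (\<Union>N. star_prod (vs N))"
  proof (rule gf_bound_UN)
    fix N
    have "(\<Sum>v\<leftarrow>vs N. x ^ length v) \<le> C * (1 / (1 - x))"
      using le[OF x, of N] mult_left_mono[OF sum_powers_le[OF x, of N] C] by linarith
    then show "gf_bound x (exp (C * (1 / (1 - x)) / (1 - x))) (star_prod (vs N))"
      using x by (intro gf_bound_mono[OF gf_bound_star_prod[OF x ne[of N]]] order_refl)
        (simp add: divide_right_mono del: times_divide_eq_right)
  next
    fix M N :: nat assume "M \<le> N"
    then show "star_prod (vs M) \<subseteq> star_prod (vs N)"
      by (rule lift_Suc_mono_le[of "\<lambda>N. star_prod (vs N)", OF mono])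
  qed
qed

section \<open>Runs of an admissible word\<close>

text \<open>Entries 0 are allowed as empty runs, so that repeated \<open>False\<close>s need no
  separate treatment.\<close>

definition blk :: "nat list \<Rightarrow> bool list" where
  "blk rs = concat (map (\<lambda>r. replicate r True @ [False]) rs)"

lemma blk_simps [simp]:
  "blk [] = []"
  "blk (r # rs) = replicate r True @ False # blk rs"
  "blk (rs @ ss) = blk rs @ blk ss"
  by (auto simp: blk_def)

lemma blk_replicate_0 [simp]: "blk (replicate q 0) = replicate q False"
  by (induction q) auto

lemma blk_concat: "blk (concat rss) = concat (map blk rss)"
  by (induction rss) auto

lemma False_prefix_ends_False: "\<exists>y. False # blk rs = y @ [False]"
  by (cases rs rule: rev_cases) auto

lemma runs_decomposition: "\<exists>r rs. w = blk rs @ replicate r True"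
proof (induction w)
  case Nil
  then show ?case by (intro exI[of _ 0] exI[of _ "[]"]) auto
next
  case (Cons a w)
  then obtain r rs where w: "w = blk rs @ replicate r True" by blast
  show ?case
  proof (cases a)
    case False
    then have "a # w = blk (0 # rs) @ replicate r True" using w by simp
    then show ?thesis by blast
  next
    case True
    show ?thesis
    proof (cases rs)
      case Nil
      then have "a # w = blk [] @ replicate (Suc r) True" using w True by simp
      then show ?thesis by blast
    next
      case (Cons r' rs')
      then have "a # w = blk (Suc r' # rs') @ replicate r True" using w True by simp
      then show ?thesis by blast
    qed
  qed
qed

text \<open>
  A run of even length \<open>c\<close> never starts a \<open>low\<close> list, so the two neighbours of the run before it have
  to satisfy the comparison. Hence evenness propagates to the left: among two consecutive runs
  before an even run, at least one is even.
\<close>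
definition even_rule :: "nat list \<Rightarrow> bool" where
  "even_rule rs \<longleftrightarrow>
     (\<forall>xs a c ys. rs = xs @ a # c # ys \<longrightarrow> a \<noteq> 0 \<longrightarrow> even c \<longrightarrow> a \<in> {1, 2}) \<and>
     (\<forall>xs p a c ys. rs = xs @ p # a # c # ys \<longrightarrow> a \<noteq> 0 \<longrightarrow> even c \<longrightarrow> even p \<and> p \<le> c)"

lemma even_ruleD1: "even_rule rs \<Longrightarrow> rs = xs @ a # c # ys \<Longrightarrow> a \<noteq> 0 \<Longrightarrow> even c \<Longrightarrow> a = 1 \<or> a = 2"
  unfolding even_rule_def by blast

lemma even_ruleD2:
  "even_rule rs \<Longrightarrow> rs = xs @ p # a # c # ys \<Longrightarrow> a \<noteq> 0 \<Longrightarrow> even c \<Longrightarrow> even p \<and> p \<le> c"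
  unfolding even_rule_def by blast

lemma even_rule_factor:
  assumes "even_rule (us @ rs @ vs)"
  shows "even_rule rs"
  unfolding even_rule_def
proof (intro conjI allI impI)
  fix xs a c ys
  assume "rs = xs @ a # c # ys" and ac: "a \<noteq> 0" "even c"
  then have "us @ rs @ vs = (us @ xs) @ a # c # (ys @ vs)" by simp
  from even_ruleD1[OF assms this ac] show "a \<in> {1, 2}" by blast
next
  fix xs p a c ys
  assume "rs = xs @ p # a # c # ys" and ac: "a \<noteq> 0" "even c"
  then have "us @ rs @ vs = (us @ xs) @ p # a # c # (ys @ vs)" by simp
  from even_ruleD2[OF assms this ac] show "even p" "p \<le> c" by auto
qed

text \<open>The first two clauses of \<open>admissible\<close> joined, with the comparison
  restricted to those parts of past and future that already decide it.\<close>

lemma admissible_one_two: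
  assumes "admissible k (xs @ p @ False # replicate a True @ False # s @ ys)" "a = 1 \<or> a = 2" "\<not> low k s"
  shows "\<not> ugt (rev p) s"
proof -
  have "admissible k (xs @ (p @ False # replicate a True @ False # s) @ ys)"
    using assms(1) by simp
  from admissible_factor[OF this]
  have "admissible k (p @ False # replicate a True @ False # s)" .
  from admissibleD(1,2)[OF this] assms(2,3) show ?thesis
    by (auto simp: numeral_2_eq_2)
qed

lemma admissible_even_rule:
  assumes adm: "admissible k (False # blk rs)"
  shows "even_rule rs"
proof -
  have nl: "\<not> low k (replicate c True @ [False])" if "even c" for c
    using not_low_even_run[OF that, of k "[]"] by simp
  have pair: "a = 1 \<or> a = 2" if rs: "rs = xs @ a # c # ys" and ac: "a \<noteq> 0" "even c" for xs a c ys
  proof (rule ccontr)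
    assume "\<not> ?thesis"
    \<comment> \<open>Such a run would force \<open>low\<close> on a list that starts with an even
      run.\<close>
    then have "3 \<le> a" using ac(1) by auto
    then obtain b where "a = b + 3" by (metis le_add_diff_inverse2)
    then have "replicate a True = replicate b True @ replicate 3 True"
      by (simp only: replicate_add)
    then have "replicate a True = replicate b True @ [True, True, True]"
      by (simp add: numeral_3_eq_3)
    then have "admissible k ((False # blk xs @ replicate b True)
        @ ([True, True, True, False] @ replicate c True @ [False]) @ blk ys)"
      using adm rs by simp
    from admissibleD(3)[OF admissible_factor[OF this], of "[]"] nl[OF ac(2)] show False by simp
  qed
  have "even p \<and> p \<le> c"
    if rs: "rs = xs @ p # a # c # ys" and ac: "a \<noteq> 0" "even c" for xs p a c ys
  proof (rule ccontr)
    assume *: "\<not> ?thesis"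
    \<comment> \<open>The separator before the run of length \<open>p\<close> has to belong to the
      past, because it marks where that run ends.\<close>
    obtain y where y: "False # blk xs = y @ [False]" using False_prefix_ends_False by blast
    have a: "a = 1 \<or> a = 2" using pair[of "xs @ [p]"] that by simp
    have "False # blk rs = (False # blk xs) @ replicate p True @ False # replicate a True @ False
        # (replicate c True @ [False]) @ blk ys"
      using rs by simp
    then have "admissible k (y @ (False # replicate p True) @ False # replicate a True @ False
        # (replicate c True @ [False]) @ blk ys)"
      using adm unfolding y by simp
    from admissible_one_two[OF this a nl[OF ac(2)]]
    have "\<not> ugt (replicate p True @ [False]) (replicate c True @ [False])" by simp
    moreover have "odd p \<or> c < p" using * by auto
    ultimately show False using ugt_run[OF ac(2), of p "[]" "[]"] by simp
  qed
  with pair show ?thesis unfolding even_rule_def by blast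
qed

section \<open>The stretch of nonzero runs up to the last even run\<close>

text \<open>The 2 stands before an even run, so the entry to its left is even; that entry itself
  stands before the even run 2, so it is 1 or 2, hence 2. The argument repeats to the left.\<close>

lemma even_rule_twos:
  assumes "even_rule (es @ [2, c])" "0 \<notin> set es" "even c"
  shows "es = replicate (length es) 2"
  using assms
proof (induction es arbitrary: c rule: rev_induct)
  case (snoc p es)
  have "even p" using even_ruleD2[of _ es p 2 c "[]"] snoc.prems by simp
  moreover have "p = 1 \<or> p = 2"
    using even_ruleD1[of _ es p 2 "[c]"] snoc.prems by simp
  ultimately have "p = 2" by auto
  then have "even_rule (es @ [2, 2])"
    using even_rule_factor[of "[]" "es @ [2, 2]" "[c]"] snoc.prems by simp
  then have "es = replicate (length es) 2" using snoc.IH[of 2] snoc.prems by simp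
  then have "es @ [2] = replicate (Suc (length es)) 2"
    by (metis replicate_append_same replicate_Suc)
  then show ?case using \<open>p = 2\<close> by simp
qed simp

text \<open>Read from the right. The entry before the last one is 2, and then all earlier entries
  are 2, or it is 1, and then the entry before it is even and not larger than the last.
  \<open>cs0\<close> holds a run before the first pair; the clause on \<open>last cs\<close> passes
  the bound on \<open>c\<close> through the induction.\<close>

lemma even_rule_nonzero_runs:
  assumes "even_rule es" "0 \<notin> set es" "es = [] \<or> even (last es)"
  shows "\<exists>n cs0 cs. es = replicate n 2 @ cs0 @ concat (map (\<lambda>c. [1, c]) cs) \<and> length cs0 \<le> 1 \<and>
    sorted cs \<and> (cs = [] \<or> last cs = last es)"
  using assms
proof (induction es rule: length_induct)
  case (1 es)
  consider "es = []" | c where "es = [c]" | es' a c where "es = es' @ [a, c]"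
    by (metis append_Cons append_Nil append_assoc rev_exhaust)
  then show ?case
  proof cases
    case 1
    then show ?thesis by (intro exI[of _ 0] exI[of _ "[]"]) simp
  next
    case (2 c)
    then show ?thesis by (intro exI[of _ 0] exI[of _ "[c]"] exI[of _ "[]"]) simp
  next
    case (3 es' a c)
    have c: "even c" "a \<noteq> 0" using "1.prems" 3 by auto
    have "a = 1 \<or> a = 2" using even_ruleD1[OF "1.prems"(1), of es' a c "[]"] 3 c by simp
    then show ?thesis
    proof
      assume a: "a = 2"
      then have "es' = replicate (length es') 2" using even_rule_twos[of es' c] "1.prems" 3 c by simp
      then have "es' @ [2] = replicate (Suc (length es')) 2"
        by (metis replicate_append_same replicate_Suc)
      then have "es = replicate (Suc (length es')) 2 @ [c] @ concat (map (\<lambda>c. [1, c]) [])"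
        using 3 a by simp
      then show ?thesis
        by (intro exI[of _ "Suc (length es')"] exI[of _ "[c]"] exI[of _ "[]"]) simp
    next
      assume a: "a = 1"
      have last: "es' = [] \<or> even (last es') \<and> last es' \<le> c"
      proof (cases es' rule: rev_cases)
        case (snoc es'' p)
        then show ?thesis using even_ruleD2[OF "1.prems"(1), of es'' p a c "[]"] 3 c by simp
      qed simp
      have "even_rule es'" using even_rule_factor[of "[]" es' "[a, c]"] "1.prems" 3 by simp
      then obtain n cs0 cs where IH: "es' = replicate n 2 @ cs0 @ concat (map (\<lambda>c. [1, c]) cs)"
        "length cs0 \<le> 1" "sorted cs" "cs = [] \<or> last cs = last es'"
        using "1.IH"[rule_format, of es'] 3 last "1.prems" by auto
      have "x \<le> c" if "x \<in> set cs" for x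
      proof (cases cs rule: rev_cases)
        case (snoc cs' z)
        have "x \<le> z" using that IH(3) snoc by (auto simp: sorted_append)
        then show ?thesis using IH(1,4) snoc last by auto
      qed (use that in simp)
      then have "sorted (cs @ [c])" using IH(3) by (simp add: sorted_append)
      moreover have "es = replicate n 2 @ cs0 @ concat (map (\<lambda>c. [1, c]) (cs @ [c]))"
        using 3 a IH(1) by simp
      ultimately show ?thesis
        using IH(2) 3 by (intro exI[of _ n] exI[of _ cs0] exI[of _ "cs @ [c]"]) simp
    qed
  qed
qed

text \<open>The pairs of \<open>even_rule_nonzero_runs\<close>: one word of length
  \<open>c + 3\<close> for each \<open>c\<close>, as in partitions. The cutoff \<open>N\<close>
  keeps each product finite.\<close>

definition ascending :: "bool list set" where
  "ascending = (\<Union>N. star_prod (map (\<lambda>c. blk [1, c]) [0..<N]))"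

lemma subexponential_ascending: "subexponential ascending"
  unfolding ascending_def
proof (rule subexponential_star_prod_UN[where C = 1])
  fix x :: real and N assume x: "0 < x" "x < 1"
  have "(\<Sum>v\<leftarrow>map (\<lambda>c. blk [1, c]) [0..<N]. x ^ length v) = (\<Sum>c<N. x ^ (c + 3))"
    by (simp add: sum_list_distinct_conv_sum_set atLeast0LessThan comp_def numeral_3_eq_3)
  also have "\<dots> \<le> (\<Sum>c<N. x ^ c)"
    using x by (intro sum_mono power_decreasing) auto
  finally show "(\<Sum>v\<leftarrow>map (\<lambda>c. blk [1, c]) [0..<N]. x ^ length v) \<le> 1 * (\<Sum>c<N. x ^ c)" by simp
next
  fix N
  show "star_prod (map (\<lambda>c. blk [1, c]) [0..<N]) \<subseteq> star_prod (map (\<lambda>c. blk [1, c]) [0..<Suc N])"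
  proof
    fix w assume "w \<in> star_prod (map (\<lambda>c. blk [1, c]) [0..<N])"
    from concI[OF this Nil_star_prod[of "[blk [1, N]]"]]
    show "w \<in> star_prod (map (\<lambda>c. blk [1, c]) [0..<Suc N])"
      by (simp add: star_prod_append del: star_prod.simps)
  qed
qed auto

lemma sorted_split_less:
  fixes cs :: "nat list"
  assumes "sorted cs" "\<forall>c\<in>set cs. c < Suc N"
  shows "\<exists>ds m. cs = ds @ replicate m N \<and> sorted ds \<and> (\<forall>c\<in>set ds. c < N)"
  using assms
proof (induction cs rule: rev_induct)
  case (snoc c cs)
  then obtain ds m where IH: "cs = ds @ replicate m N" "sorted ds" "\<forall>c\<in>set ds. c < N"
    by (auto simp: sorted_append)
  show ?case
  proof (cases "c = N")
    case True
    then have "cs @ [c] = ds @ replicate (Suc m) N" using IH by (simp add: replicate_append_same)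
    then show ?thesis using IH by blast
  next
    case False
    then have "c < N" using snoc.prems by auto
    then have "m = 0" using snoc.prems IH by (cases m) (auto simp: sorted_append)
    then have "cs @ [c] = (ds @ [c]) @ replicate 0 N" "sorted (ds @ [c])" "\<forall>x\<in>set (ds @ [c]). x < N"
      using IH snoc.prems \<open>c < N\<close> by (auto simp: sorted_append)
    then show ?thesis by blast
  qed
qed auto

lemma sorted_ascending:
  assumes "sorted cs"
  shows "blk (concat (map (\<lambda>c. [1, c]) cs)) \<in> ascending"
proof -
  have "blk (concat (map (\<lambda>c. [1, c]) cs)) \<in> star_prod (map (\<lambda>c. blk [1, c]) [0..<N])"
    if "sorted cs" "\<forall>c\<in>set cs. c < N" for N
    using that
  proof (induction N arbitrary: cs)
    case (Suc N)
    then obtain ds m where ds: "cs = ds @ replicate m N" "sorted ds" "\<forall>c\<in>set ds. c < N"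
      using sorted_split_less by blast
    have "concat (replicate m (blk [1, N])) \<in> star_prod [blk [1, N]]"
      using concI[OF starI, of "[]" "{[]}" m "blk [1, N]"] by simp
    from concI[OF Suc.IH[OF ds(2,3)] this]
    show ?case unfolding ds(1)
      by (simp add: star_prod_append blk_concat map_replicate_const comp_def
          map_concat del: star_prod.simps)
  qed simp
  from this[OF assms, of "Suc (Max (set cs))"]
  have "blk (concat (map (\<lambda>c. [1, c]) cs)) \<in> star_prod (map (\<lambda>c. blk [1, c]) [0..<Suc (Max (set cs))])"
    by (simp add: less_Suc_eq_le del: upt_Suc)
  then show ?thesis unfolding ascending_def by blast
qed

section \<open>The stretch up to the last empty run\<close>

definition zrun :: "nat \<Rightarrow> nat \<Rightarrow> bool list" where
  "zrun q a = blk (a # replicate q 0)"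

lemma zrun_eq: "zrun q a = replicate a True @ False # replicate q False"
  by (simp add: zrun_def)

definition zruns :: "(nat \<times> nat) list \<Rightarrow> bool list" where
  "zruns ps = concat (map (\<lambda>(a, q). zrun q a) ps)"

lemma zruns_simps [simp]:
  "zruns [] = []"
  "zruns ((a, q) # ps) = zrun q a @ zruns ps"
  "zruns (ps @ qs) = zruns ps @ zruns qs"
  by (auto simp: zruns_def)

lemma blk_zruns: "blk (concat (map (\<lambda>(a, q). a # replicate q 0) ps)) = zruns ps"
  by (induction ps) (auto simp: zrun_def)

text \<open>Zero is even, so a nonzero entry before it is 1 or 2, and the entry before that is even
  and at most 0. Hence nonzero entries are separated by blocks of zeros.\<close>

lemma even_rule_zero_runs:
  assumes "even_rule zs" "zs = [] \<or> last zs = 0"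
  shows "\<exists>q0 ps. zs = replicate q0 0 @ concat (map (\<lambda>(a, q). a # replicate q 0) ps) \<and>
    (\<forall>(a, q)\<in>set ps. (a = 1 \<or> a = 2) \<and> 1 \<le> q)"
  using assms
proof (induction zs rule: length_induct)
  case (1 zs)
  show ?case
  proof (cases zs rule: rev_cases)
    case Nil
    then show ?thesis by (intro exI[of _ 0] exI[of _ "[]"]) simp
  next
    case (snoc zs' z)
    then have z: "z = 0" "even_rule zs'"
      using "1.prems" even_rule_factor[of "[]" zs' "[z]"] by auto
    show ?thesis
    proof (cases "zs' = [] \<or> last zs' = 0")
      case True
      then obtain q0 ps where IH:
        "zs' = replicate q0 0 @ concat (map (\<lambda>(a, q). a # replicate q 0) ps)"
        "\<forall>(a, q)\<in>set ps. (a = 1 \<or> a = 2) \<and> 1 \<le> q"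
        using "1.IH"[rule_format, of zs'] z snoc by auto
      show ?thesis
      proof (cases ps rule: rev_cases)
        case Nil
        then have "zs = replicate (Suc q0) 0 @ concat (map (\<lambda>(a, q). a # replicate q 0) [])"
          using IH snoc z by (simp add: replicate_append_same)
        then show ?thesis by (intro exI[of _ "Suc q0"] exI[of _ "[]"]) simp
      next
        case (snoc ps' p)
        obtain a q where p: "p = (a, q)" by fastforce
        have "zs = replicate q0 0 @ concat (map (\<lambda>(a, q). a # replicate q 0) (ps' @ [(a, Suc q)]))"
          using IH \<open>zs = _\<close> z snoc p by (simp add: replicate_append_same)
        then show ?thesis using IH snoc p
          by (intro exI[of _ q0] exI[of _ "ps' @ [(a, Suc q)]"]) auto
      qed
    next
      case False
      then obtain zs'' a where a: "zs' = zs'' @ [a]" "a \<noteq> 0"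
        by (cases zs' rule: rev_cases) auto
      have a12: "a = 1 \<or> a = 2"
        using even_ruleD1[OF "1.prems"(1), of zs'' a 0 "[]"] a z snoc by simp
      have "zs'' = [] \<or> last zs'' = 0"
      proof (cases zs'' rule: rev_cases)
        case (snoc us p)
        then show ?thesis
          using even_ruleD2[OF "1.prems"(1), of us p a 0 "[]"] a z \<open>zs = _\<close> by simp
      qed simp
      moreover have "even_rule zs''" using even_rule_factor[of "[]" zs'' "[a]"] a z by simp
      ultimately obtain q0 ps where IH:
        "zs'' = replicate q0 0 @ concat (map (\<lambda>(a, q). a # replicate q 0) ps)"
        "\<forall>(a, q)\<in>set ps. (a = 1 \<or> a = 2) \<and> 1 \<le> q"
        using "1.IH"[rule_format, of zs''] a snoc by auto
      have "zs = replicate q0 0 @ concat (map (\<lambda>(a, q). a # replicate q 0) (ps @ [(a, 1)]))"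
        using IH snoc a z by simp
      then show ?thesis using IH a12
        by (intro exI[of _ q0] exI[of _ "ps @ [(a, 1)]"]) auto
    qed
  qed
qed

definition zero_rule :: "(nat \<times> nat) list \<Rightarrow> bool" where
  "zero_rule ps \<longleftrightarrow>
     (\<forall>xs b q a q' ys. ps = xs @ (b, q) # (a, q') # ys \<longrightarrow> q' \<le> q) \<and>
     (\<forall>xs q a ys. ps \<noteq> xs @ (1, q) # (a, q) # (2, q) # ys)"

lemma zero_rule_factor:
  assumes "zero_rule (us @ ps @ vs)"
  shows "zero_rule ps"
  unfolding zero_rule_def
proof (intro conjI allI impI notI)
  fix xs b q a q' ys
  assume "ps = xs @ (b, q) # (a, q') # ys"
  then have "us @ ps @ vs = (us @ xs) @ (b, q) # (a, q') # (ys @ vs)" by simp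
  then show "q' \<le> q" using assms unfolding zero_rule_def by blast
next
  fix xs q a ys
  assume "ps = xs @ (1, q) # (a, q) # (2, q) # ys"
  then have "us @ ps @ vs = (us @ xs) @ (1, q) # (a, q) # (2, q) # (ys @ vs)" by simp
  then show False using assms unfolding zero_rule_def by blast
qed

lemma zruns_prefix_ends_False: "\<exists>y. False # replicate q0 False @ zruns ps = y @ [False]"
proof (cases ps rule: rev_cases)
  case Nil
  then show ?thesis by (auto simp: replicate_append_same[symmetric])
next
  case (snoc ps' p)
  obtain a q where "p = (a, q)" by fastforce
  moreover have "zrun q a = (replicate a True @ replicate q False) @ [False]"
    by (simp add: zrun_eq replicate_append_same)
  ultimately have "False # replicate q0 False @ zruns ps
      = (False # replicate q0 False @ zruns ps' @ replicate a True @ replicate q False) @ [False]"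
    using snoc by simp
  then show ?thesis by blast
qed

text \<open>The future of a run \<open>a\<close> starts with \<open>False\<close>, so it is not
  \<open>low\<close> and must not be smaller than the past. With fewer zeros the past has the first
  change and is larger. With equally many zeros the next runs decide, and 1 in the past beats 2 in
  the future because of the swap after their common \<open>True\<close>.\<close>

lemma admissible_zero_rule:
  assumes adm: "admissible k (False # replicate q0 False @ zruns ps)"
    and ps: "\<forall>(a, q)\<in>set ps. (a = 1 \<or> a = 2) \<and> 1 \<le> q"
  shows "zero_rule ps"
  unfolding zero_rule_def
proof (intro conjI allI impI notI)
  fix xs b q a q' ys
  assume eq: "ps = xs @ (b, q) # (a, q') # ys"
  then have a: "a = 1 \<or> a = 2" and b: "b = 1 \<or> b = 2" and q': "1 \<le> q'" using ps by auto
  show "q' \<le> q"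
  proof (rule ccontr)
    assume "\<not> q' \<le> q"
    then obtain d where d: "q' = q + Suc d"
      by (metis add_Suc_right less_imp_Suc_add not_le)
    obtain b' where b': "replicate b True = replicate b' True @ [True]"
      using b by (metis Suc_1 empty_replicate One_nat_def replicate_Suc replicate_append_same)
    have "False # replicate q False = replicate q False @ [False]"
      by (simp add: replicate_append_same)
    then have "False # replicate q0 False @ zruns ps = (False # replicate q0 False @ zruns xs @ replicate b' True)
        @ (True # replicate q False) @ False # replicate a True @ False # replicate q' False @ zruns ys"
      using eq b' by (simp add: zrun_eq)
    from admissible_one_two[OF adm[unfolded this] a] q'
    have "\<not> ugt (replicate q False @ [True]) (replicate q' False)"
      using not_low_False by (cases q') auto
    then show False unfolding d replicate_add by simp
  qed
next
  fix xs q a ys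
  assume eq: "ps = xs @ (1, q) # (a, q) # (2, q) # ys"
  then have a: "a = 1 \<or> a = 2" and q: "1 \<le> q" using ps by auto
  \<comment> \<open>This separator shows that the run in the past has length exactly one.\<close>
  obtain y where y: "False # replicate q0 False @ zruns xs = y @ [False]"
    using zruns_prefix_ends_False by blast
  have "False # replicate q0 False @ zruns ps
      = (False # replicate q0 False @ zruns xs) @ zrun q 1 @ zrun q a @ zrun q 2 @ zruns ys"
    using eq by simp
  also have "\<dots> = y @ (False # True # replicate q False) @ False # replicate a True @ False
      # (replicate q False @ [True, True, False]) @ (replicate q False @ zruns ys)"
    unfolding y by (simp add: zrun_eq numeral_2_eq_2 replicate_append_same)
  finally have "False # replicate q0 False @ zruns ps = \<dots>" .
  moreover have "\<not> low k (replicate q False @ [True, True, False])"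
    using q not_low_False by (cases q) auto
  ultimately have "\<not> ugt (rev (False # True # replicate q False)) (replicate q False @ [True, True, False])"
    using admissible_one_two[OF _ a] adm by metis
  then have "\<not> ugt (replicate q False @ [True, False]) (replicate q False @ [True, True, False])"
    by simp
  then show False by simp
qed

text \<open>A 1 may be prepended only if the third entry of the result is not 2. So it meets a tail
  of 1s, or a single leading 2 with which it forms a new \<open>[1, 2]\<close>.\<close>

lemma one_two_lists:
  assumes "set as \<subseteq> {1, 2}" "\<And>xs b ys. as \<noteq> xs @ 1 # b # 2 # ys"
  shows "\<exists>i j l. as = replicate i 2 @ concat (replicate j [1, 2]) @ replicate l (1::nat)"
  using assms
proof (induction as)
  case Nil
  then show ?case by (intro exI[of _ 0]) simp
next
  case (Cons a as)
  have "as \<noteq> xs @ 1 # b # 2 # ys" for xs b ys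
    using Cons.prems(2)[of "a # xs" b ys] by simp
  then obtain i j l where IH: "as = replicate i 2 @ concat (replicate j [1, 2]) @ replicate l 1"
    using Cons.IH Cons.prems(1) by auto
  consider "a = 2" | "a = 1" "i = 0" "j = 0" | "a = 1" "i = 0" "j \<noteq> 0" | "a = 1" "i = 1"
    | "a = 1" "i \<ge> 2"
    using Cons.prems(1) by fastforce
  then show ?case
  proof cases
    case 1
    then show ?thesis using IH by (intro exI[of _ "Suc i"] exI[of _ j] exI[of _ l]) simp
  next
    case 2
    then show ?thesis using IH by (intro exI[of _ 0] exI[of _ 0] exI[of _ "Suc l"]) simp
  next
    case 3
    then obtain j' where "j = Suc j'" by (cases j) auto
    then show ?thesis using IH 3 Cons.prems(2)[of "[]" 1 "concat (replicate j' [1, 2]) @ replicate l 1"]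
      by simp
  next
    case 4
    then show ?thesis using IH by (intro exI[of _ 0] exI[of _ "Suc j"] exI[of _ l]) simp
  next
    case 5
    then obtain i' where "i = 2 + i'" by (auto simp: le_iff_add)
    then have "i = Suc (Suc i')" by simp
    then show ?thesis
      using IH 5 Cons.prems(2)[of "[]" 2 "replicate i' 2 @ concat (replicate j [1, 2]) @ replicate l 1"]
      by simp
  qed
qed

lemma concat_map_replicate:
  "concat (map f (concat (replicate n xs))) = concat (replicate n (concat (map f xs)))"
  by (induction n) auto

text \<open>For each \<open>q\<close>, taken downwards, the three words of the shape in
  \<open>one_two_lists\<close>; their lengths exceed \<open>q\<close>, so three words are charged to
  each power of \<open>x\<close>.\<close>

definition descending :: "bool list set" where
  "descending =
     (\<Union>N. star_prod (concat (map (\<lambda>q. [zrun q 2, zrun q 1 @ zrun q 2, zrun q 1]) (rev [0..<N]))))"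

lemma subexponential_descending: "subexponential descending"
  unfolding descending_def
proof (rule subexponential_star_prod_UN[where C = 3])
  fix x :: real and N assume x: "0 < x" "x < 1"
  let ?vs = "\<lambda>N. concat (map (\<lambda>q. [zrun q 2, zrun q 1 @ zrun q 2, zrun q 1]) (rev [0..<N]))"
  show "(\<Sum>v\<leftarrow>?vs N. x ^ length v) \<le> 3 * (\<Sum>c<N. x ^ c)"
  proof (induction N)
    case (Suc N)
    have "x ^ length (zrun N 2) \<le> x ^ N" "x ^ length (zrun N 1 @ zrun N 2) \<le> x ^ N"
      "x ^ length (zrun N 1) \<le> x ^ N"
      using x by (auto simp: zrun_eq intro!: power_decreasing simp del: power_Suc)
    then show ?case using Suc by simp
  qed simp
next
  fix N
  let ?vs = "\<lambda>N. concat (map (\<lambda>q. [zrun q 2, zrun q 1 @ zrun q 2, zrun q 1]) (rev [0..<N]))"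
  have eq: "?vs (Suc N) = [zrun N 2, zrun N 1 @ zrun N 2, zrun N 1] @ ?vs N" by simp
  show "star_prod (?vs N) \<subseteq> star_prod (?vs (Suc N))"
  proof
    fix w assume "w \<in> star_prod (?vs N)"
    from concI[OF Nil_star_prod[of "[zrun N 2, zrun N 1 @ zrun N 2, zrun N 1]"] this]
    show "w \<in> star_prod (?vs (Suc N))" unfolding eq star_prod_append by simp
  qed
qed (auto simp: zrun_eq)

lemma zero_rule_hd_max:
  assumes "zero_rule (p # ps)"
  shows "\<forall>r\<in>set ps. snd r \<le> snd p"
  using assms
proof (induction ps arbitrary: p)
  case (Cons r ps)
  have "snd r \<le> snd p"
    using Cons.prems unfolding zero_rule_def
    by (metis append_Nil prod.collapse)
  moreover have "zero_rule (r # ps)" using zero_rule_factor[of "[p]" "r # ps" "[]"] Cons.prems by simp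
  ultimately show ?case using Cons.IH[of r] by force
qed simp

lemma zero_rule_descending:
  assumes "zero_rule ps" "\<forall>(a, q)\<in>set ps. a = 1 \<or> a = 2"
  shows "zruns ps \<in> descending"
proof -
  let ?vs = "\<lambda>N. concat (map (\<lambda>q. [zrun q 2, zrun q 1 @ zrun q 2, zrun q 1]) (rev [0..<N]))"
  have "zruns ps \<in> star_prod (?vs N)" if "zero_rule ps" "\<forall>(a, q)\<in>set ps. (a = 1 \<or> a = 2) \<and> q < N" for N
    using that
  proof (induction N arbitrary: ps)
    case 0
    then have "ps = []" by (cases ps) auto
    then show ?case by simp
  next
    case (Suc N)
    \<comment> \<open>As \<open>q\<close> never increases, the pairs with the largest permitted
      value \<open>N\<close> come first; the others are left to the induction.\<close>
    define ps1 where "ps1 = takeWhile (\<lambda>p. snd p = N) ps"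
    define ps2 where "ps2 = dropWhile (\<lambda>p. snd p = N) ps"
    have ps: "ps = ps1 @ ps2" by (simp add: ps1_def ps2_def)
    have zr: "zero_rule ps1" "zero_rule ps2"
      using zero_rule_factor[of "[]" ps1 ps2] zero_rule_factor[of ps1 ps2 "[]"] Suc.prems ps by simp_all
    have "\<forall>(a, q)\<in>set ps2. q < N"
    proof (cases ps2)
      case (Cons p ps2')
      have "snd p \<noteq> N" using hd_dropWhile[of "\<lambda>p. snd p = N" ps] Cons by (simp add: ps2_def[symmetric])
      moreover have "snd p < Suc N" using Suc.prems(2) ps Cons by auto
      ultimately show ?thesis using zero_rule_hd_max[of p ps2'] zr Cons by fastforce
    qed simp
    then have 2: "zruns ps2 \<in> star_prod (?vs N)"
      using Suc.prems(2) zr ps by (intro Suc.IH) auto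
    define as where "as = map fst ps1"
    have "\<forall>p\<in>set ps1. snd p = N" unfolding ps1_def by (metis set_takeWhileD)
    then have ps1: "ps1 = map (\<lambda>a. (a, N)) as"
      unfolding as_def by (simp add: map_idI[symmetric] comp_def) (metis (mono_tags, lifting) map_idI prod.collapse)
    have "set as \<subseteq> {1, 2}" using Suc.prems(2) ps by (auto simp: as_def)
    moreover have "as \<noteq> xs @ 1 # b # 2 # ys" for xs b ys
    proof
      assume "as = xs @ 1 # b # 2 # ys"
      then have "ps1 = map (\<lambda>a. (a, N)) xs @ (1, N) # (b, N) # (2, N) # map (\<lambda>a. (a, N)) ys"
        using ps1 by simp
      then show False using zr(1) unfolding zero_rule_def by blast
    qed
    ultimately obtain i j l where as: "as = replicate i 2 @ concat (replicate j [1, 2]) @ replicate l 1"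
      using one_two_lists by blast
    have zr_map: "zruns (map (\<lambda>a. (a, N)) us) = concat (map (zrun N) us)" for us
      by (induction us) auto
    have "zruns ps1 = concat (replicate i (zrun N 2)) @ concat (replicate j (zrun N 1 @ zrun N 2))
        @ concat (replicate l (zrun N 1)) @ []"
      unfolding ps1 zr_map as by (simp add: concat_map_replicate)
    also have "\<dots> \<in> star_prod [zrun N 2, zrun N 1 @ zrun N 2, zrun N 1]"
      unfolding star_prod.simps by (intro concI starI) simp
    finally have 1: "zruns ps1 \<in> star_prod [zrun N 2, zrun N 1 @ zrun N 2, zrun N 1]" .
    have eq: "?vs (Suc N) = [zrun N 2, zrun N 1 @ zrun N 2, zrun N 1] @ ?vs N" by simp
    show ?case unfolding eq star_prod_append ps zruns_simps by (rule concI[OF 1 2])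
  qed
  moreover have "\<forall>(a, q)\<in>set ps. (a = 1 \<or> a = 2) \<and> q < Suc (Max (snd ` set ps))"
  proof safe
    fix a q assume "(a, q) \<in> set ps"
    then have "q \<in> snd ` set ps" by force
    then show "q < Suc (Max (snd ` set ps))" by (simp add: less_Suc_eq_le)
  qed (use assms(2) in auto)
  ultimately have "zruns ps \<in> star_prod (?vs (Suc (Max (snd ` set ps))))"
    using assms(1) by blast
  then show ?thesis unfolding descending_def by blast
qed

section \<open>Odd runs and the induction on \<open>k\<close>\<close>

text \<open>A run of length \<open>2 * s + 1\<close> and its separator form
  \<open>pd (replicate s False @ [True])\<close>.\<close>

lemma odd_runs_pd:
  assumes "\<forall>r\<in>set os. odd r"
  shows "\<exists>w. blk os = pd w"
  using assms
proof (induction os)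
  case Nil
  then show ?case by (intro exI[of _ "[]"]) simp
next
  case (Cons r os)
  then obtain w where w: "blk os = pd w" by auto
  from Cons obtain s where s: "r = Suc (2 * s)" by (auto elim: oddE)
  have "replicate (2 * s) True = pd (replicate s False)" by (induction s) auto
  moreover have "replicate r True = replicate (2 * s) True @ [True]"
    by (simp add: s replicate_append_same)
  ultimately have "blk (r # os) = pd (replicate s False @ True # w)"
    using w by simp
  then show ?case ..
qed

definition odd_part :: "nat \<Rightarrow> bool list set" where
  "odd_part k = {blk os |os. (\<forall>r\<in>set os. odd r) \<and> admissible k (blk os)}"

lemma odd_part_Suc: "odd_part (Suc k) \<subseteq> pd ` {w. admissible k w}"
  unfolding odd_part_def using odd_runs_pd admissible_pdD by force

text \<open>At level 0 no list is \<open>low\<close>, which excludes runs of three or more; odd runs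
  then have length one.\<close>

lemma odd_part_0: "odd_part 0 \<subseteq> star [True, False]"
proof
  fix w assume "w \<in> odd_part 0"
  then obtain os where os: "w = blk os" "\<forall>r\<in>set os. odd r" "admissible 0 (blk os)"
    unfolding odd_part_def by blast
  have "r = 1" if r_os: "r \<in> set os" for r
  proof (rule ccontr)
    assume "r \<noteq> 1"
    then have "3 \<le> r" using os(2) r_os by (cases r rule: nat.exhaust) (auto elim!: oddE simp: numeral_3_eq_3)
    then obtain b where "r = b + 3" by (metis le_add_diff_inverse2)
    then have "replicate r True = replicate b True @ replicate 3 True"
      by (simp only: replicate_add)
    then have r: "replicate r True = replicate b True @ [True, True, True]"
      by (simp add: numeral_3_eq_3)
    obtain us vs where "os = us @ r # vs" using split_list[OF r_os] by blast
    then have "blk os = (blk us @ replicate b True) @ [True, True, True, False] @ blk vs"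
      using r by simp
    from admissibleD(3)[OF os(3) this] show False by (simp add: not_low_0)
  qed
  then have "os = replicate (length os) 1" by (metis replicate_eqI)
  then have "w = concat (replicate (length os) [True, False])"
    using os(1) unfolding blk_def by (metis (no_types, lifting) One_nat_def append_Cons append_Nil map_replicate replicate_0 replicate_Suc)
  then show "w \<in> star [True, False]" using starI by metis
qed

lemma last_split:
  "\<exists>ys zs. xs = ys @ zs \<and> (ys = [] \<or> P (last ys)) \<and> (\<forall>z\<in>set zs. \<not> P z)"
proof (induction xs rule: rev_induct)
  case (snoc x xs)
  then obtain ys zs where *: "xs = ys @ zs" "ys = [] \<or> P (last ys)" "\<forall>z\<in>set zs. \<not> P z" by blast
  show ?case
  proof (cases "P x")
    case True
    then show ?thesis by (intro exI[of _ "xs @ [x]"] exI[of _ "[]"]) simp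
  next
    case False
    then show ?thesis using * by (intro exI[of _ ys] exI[of _ "zs @ [x]"]) auto
  qed
qed simp

definition nonzero_part :: "bool list set" where
  "nonzero_part = conc (star (blk [2])) (conc ({[]} \<union> conc (star [True]) {[False]}) ascending)"

text \<open>Cut after the last even run and, before that cut, after the last empty run. The pieces
  are the descending, the nonzero and the odd part.\<close>

lemma admissible_runs:
  assumes adm: "admissible k (False # blk rs)"
  shows "blk rs \<in> conc (conc (star [False]) descending) (conc nonzero_part (odd_part k))"
proof -
  obtain xs os where 1: "rs = xs @ os" "xs = [] \<or> even (last xs)" "\<forall>r\<in>set os. odd r"
    using last_split[of rs even] by blast
  obtain zs es where 2: "xs = zs @ es" "zs = [] \<or> last zs = 0" "\<forall>r\<in>set es. r \<noteq> 0"
    using last_split[of xs "\<lambda>r. r = 0"] by blast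
  have rule: "even_rule rs" using admissible_even_rule[OF adm] .
  have "even_rule zs" using even_rule_factor[of "[]" zs "es @ os"] rule 1 2 by simp
  then obtain q0 ps where zs: "zs = replicate q0 0 @ concat (map (\<lambda>(a, q). a # replicate q 0) ps)"
    "\<forall>(a, q)\<in>set ps. (a = 1 \<or> a = 2) \<and> 1 \<le> q"
    using even_rule_zero_runs 2 by blast
  have "blk rs = blk zs @ blk es @ blk os" using 1 2 by simp
  have "admissible k (False # blk zs)"
    using admissible_factor[of k "[]" "False # blk zs" "blk es @ blk os"] adm 1 2 by simp
  then have "zero_rule ps" using admissible_zero_rule zs by (simp add: blk_zruns)
  then have "zruns ps \<in> descending" using zero_rule_descending zs by blast
  then have A: "blk zs \<in> conc (star [False]) descending"
    unfolding zs(1) blk_simps blk_zruns blk_replicate_0 by (intro concI replicate_star)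
  have "even_rule es" using even_rule_factor[of zs es os] rule 1 2 by simp
  moreover have "es = [] \<or> even (last es)" using 1(2) 2(1) by (cases "es = []") auto
  ultimately obtain n cs0 cs where es: "es = replicate n 2 @ cs0 @ concat (map (\<lambda>c. [1, c]) cs)"
    "length cs0 \<le> 1" "sorted cs"
    using even_rule_nonzero_runs[of es] 2(3) by blast
  have "blk (replicate n 2) = concat (replicate n (blk [2]))" by (induction n) auto
  moreover have "blk cs0 \<in> {[]} \<union> conc (star [True]) {[False]}"
  proof (cases cs0)
    case (Cons c cs')
    then have "blk cs0 = replicate c True @ [False]" using es(2) by simp
    then show ?thesis using concI[OF replicate_star, of "[False]" "{[False]}"] by auto
  qed simp
  ultimately have B: "blk es \<in> nonzero_part"
    unfolding es(1) nonzero_part_def blk_simps using sorted_ascending[OF es(3)]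
    by (simp only:) (intro concI starI)
  have "admissible k (blk os)"
    using admissible_factor[of k "False # blk zs @ blk es" "blk os" "[]"] adm 1 2 by simp
  then have C: "blk os \<in> odd_part k" unfolding odd_part_def using 1 by blast
  show ?thesis using concI[OF A concI[OF B C]] 1 2 by simp
qed

lemma subexponential_admissible: "subexponential {w. admissible k w}"
proof (induction k)
  \<comment> \<open>All factors except the odd part are subexponential at every level, so only the
    odd part needs the induction.\<close>
  have *: "subexponential {w. admissible k w}" if "subexponential (odd_part k)" for k
  proof -
    let ?R = "conc (conc (star [False]) descending) (conc nonzero_part (odd_part k))"
    let ?I = "conc (star [True]) {[False]}"
    have "subexponential ?I" by (intro subexponential_conc subexponential_star subexponential_single) simp
    then have "subexponential nonzero_part"
      unfolding nonzero_part_def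
      by (intro subexponential_conc subexponential_star subexponential_Un subexponential_single subexponential_ascending) simp_all
    then have "subexponential ?R"
      by (intro subexponential_conc subexponential_star subexponential_descending that) simp_all
    with \<open>subexponential ?I\<close> have "subexponential (star [True] \<union> conc ?I (conc ?R (star [True])))"
      by (intro subexponential_Un subexponential_conc[of ?I] subexponential_conc[of ?R] subexponential_star) simp_all
    moreover have "{w. admissible k w} \<subseteq> star [True] \<union> conc ?I (conc ?R (star [True]))"
    proof (rule subsetI, drule CollectD)
      fix w assume adm: "admissible k w"
      \<comment> \<open>The outermost runs may be truncated by the ends of the word and are split
        off as free factors; the rest is preceded by a \<open>False\<close>.\<close>
      obtain r rs where w: "w = blk rs @ replicate r True" using runs_decomposition by blast
      show "w \<in> star [True] \<union> conc ?I (conc ?R (star [True]))"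
      proof (cases rs)
        case Nil
        then show ?thesis using w replicate_star[of r True] by simp
      next
        case (Cons r0 rs')
        then have w': "w = (replicate r0 True @ [False]) @ (blk rs' @ replicate r True)"
          using w by simp
        have "admissible k (False # blk rs')"
          using admissible_factor[of k "replicate r0 True" "False # blk rs'" "replicate r True"] adm w'
          by simp
        from admissible_runs[OF this]
        have "w \<in> conc ?I (conc ?R (star [True]))"
          unfolding w' by (intro concI replicate_star) simp_all
        then show ?thesis by simp
      qed
    qed
    ultimately show ?thesis by (rule subexponential_subset)
  qed
  case 0
  show ?case by (rule *[OF subexponential_subset[OF subexponential_star odd_part_0]]) simp
  case (Suc k)
  show ?case by (rule *[OF subexponential_subset[OF subexponential_pd[OF Suc] odd_part_Suc]])
qed

section \<open>Binary expansions\<close>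

definition bits :: "(nat \<Rightarrow> nat) \<Rightarrow> bool" where
  "bits a \<longleftrightarrow> (\<forall>n. a n \<in> {0, 1})"

definition val :: "(nat \<Rightarrow> nat) \<Rightarrow> real" where
  "val a = (\<Sum>n. real (a n) / 2 ^ (n + 1))"

definition evconst :: "(nat \<Rightarrow> nat) \<Rightarrow> bool" where
  "evconst a \<longleftrightarrow> (\<exists>N c. \<forall>n\<ge>N. a n = c)"

lemma bits_Suc: "bits a \<Longrightarrow> bits (\<lambda>n. a (Suc n))"
  by (simp add: bits_def)

lemma bits_compl: "bits a \<Longrightarrow> bits (\<lambda>n. 1 - a n)"
  by (force simp: bits_def)

lemma val_split: "bits a \<Longrightarrow> val a = (real (a 0) + val (\<lambda>n. a (Suc n))) / 2"
  unfolding val_def by (rule suminf_digits_split) (simp add: bits_def)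

lemma val_nonneg: "bits a \<Longrightarrow> 0 \<le> val a"
  unfolding val_def by (intro suminf_nonneg summable_digits) (auto simp: bits_def)

lemma val_compl: "bits a \<Longrightarrow> val (\<lambda>n. 1 - a n) = 1 - val a"
proof -
  assume a: "bits a"
  have one: "(\<lambda>n. 1 / 2 ^ (n + 1) :: real) sums 1"
    using power_half_series by (simp add: power_divide)
  have "(\<lambda>n. real (a n) / 2 ^ (n + 1)) sums val a"
    unfolding val_def using a by (intro summable_sums summable_digits) (simp add: bits_def)
  from sums_diff[OF one this]
  have "(\<lambda>n. 1 / 2 ^ (n + 1) - real (a n) / 2 ^ (n + 1)) sums (1 - val a)" .
  moreover have "1 / 2 ^ (n + 1) - real (a n) / 2 ^ (n + 1) = real (1 - a n) / 2 ^ (n + 1)" for n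
    using a[unfolded bits_def, rule_format, of n] by auto
  ultimately show ?thesis unfolding val_def by (simp add: sums_iff)
qed

lemma val_le_1: "bits a \<Longrightarrow> val a \<le> 1"
  using val_nonneg[OF bits_compl, of a] by (simp add: val_compl del: One_nat_def)

lemma val_eq_1D:
  assumes "bits a" "val a = 1"
  shows "a n = 1"
proof (rule ccontr)
  assume "a n \<noteq> 1"
  then have "a n = 0" using assms(1) by (auto simp: bits_def)
  then have "val a < 1"
    unfolding val_def using assms(1) by (intro suminf_digits_less_1[of a n]) (auto simp: bits_def)
  then show False using assms(2) by simp
qed

lemma val_eq_0D: "bits a \<Longrightarrow> val a = 0 \<Longrightarrow> a n = 0"
  using val_eq_1D[OF bits_compl, of a n] val_compl[of a] by simp

text \<open>The larger first digit wins strictly except for tails 1000... against 0111..., where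
  both sequences are eventually constant.\<close>

lemma val_less:
  assumes "bits a" "bits b" "\<forall>i<j. a i = b i" "a j = 1" "b j = 0" "\<not> (evconst a \<and> evconst b)"
  shows "val b < val a"
  using assms
proof (induction j arbitrary: a b)
  case 0
  note ab = bits_Suc[OF 0(1)] bits_Suc[OF 0(2)]
  have "val b = val (\<lambda>n. b (Suc n)) / 2" "val a = (1 + val (\<lambda>n. a (Suc n))) / 2"
    using val_split 0 by auto
  moreover have "val (\<lambda>n. b (Suc n)) \<noteq> 1 \<or> val (\<lambda>n. a (Suc n)) \<noteq> 0"
  proof (rule ccontr)
    assume "\<not> ?thesis"
    then have b: "b (Suc n) = 1" and a: "a (Suc n) = 0" for n
      using val_eq_1D[OF ab(2), of n] val_eq_0D[OF ab(1), of n] by auto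
    have "a n = 0" "b n = 1" if "n \<ge> 1" for n using a[of "n - 1"] b[of "n - 1"] that by auto
    then show False using 0 unfolding evconst_def by blast
  qed
  ultimately show ?case
    using val_nonneg[OF ab(1)] val_le_1[OF ab(2)] by auto
next
  case (Suc j)
  have ev: "evconst a" if "evconst (\<lambda>n. a (Suc n))" for a
    using that unfolding evconst_def by (metis Suc_le_D Suc_le_mono)
  have "val (\<lambda>n. b (Suc n)) < val (\<lambda>n. a (Suc n))"
    using Suc.prems ev by (intro Suc.IH bits_Suc) auto
  then show ?case using val_split[of a] val_split[of b] Suc.prems by simp
qed

lemma val_close:
  "bits a \<Longrightarrow> bits b \<Longrightarrow> \<forall>i<n. a i = b i \<Longrightarrow> \<bar>val a - val b\<bar> \<le> (1/2) ^ n"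
proof (induction n arbitrary: a b)
  case 0
  then show ?case using val_nonneg[of a] val_nonneg[of b] val_le_1[of a] val_le_1[of b] by auto
next
  case (Suc n)
  have "\<bar>val (\<lambda>i. a (Suc i)) - val (\<lambda>i. b (Suc i))\<bar> \<le> (1/2) ^ n"
    using Suc.prems by (intro Suc.IH bits_Suc) auto
  moreover have "a 0 = b 0" using Suc.prems by simp
  moreover have "val a - val b = (val (\<lambda>i. a (Suc i)) - val (\<lambda>i. b (Suc i))) / 2"
    using val_split[of a] val_split[of b] Suc.prems \<open>a 0 = b 0\<close> by simp
  ultimately show ?case by (simp only: abs_divide) simp
qed

definition flips :: "(nat \<Rightarrow> nat) \<Rightarrow> nat \<Rightarrow> bool list" where
  "flips a n = map (\<lambda>i. a i \<noteq> a (Suc i)) [0..<n]"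

lemma flips_0 [simp]: "flips a 0 = []"
  by (simp add: flips_def)

lemma flips_Suc: "flips a (Suc n) = (a 0 \<noteq> a 1) # flips (\<lambda>i. a (Suc i)) n"
  unfolding flips_def by (subst upt_conv_Cons) (simp_all add: map_Suc_upt[symmetric] comp_def del: upt_Suc)

text \<open>After a common change both sequences continue from the opposite digit, which reverses
  the order; this is the swap in \<open>ugt\<close>. The statement covers both first digits so that
  the induction can pass through a change.\<close>

lemma ugt_flips:
  assumes "bits a" "bits b" "a 0 = b 0" "ugt (flips a m) (flips b n)"
  shows "\<exists>j. (\<forall>i<j. a i = b i) \<and> a j = 1 - a 0 \<and> b j = a 0"
  using assms
proof (induction "m + n" arbitrary: a b m n rule: less_induct)
  case less
  obtain m' n' where mn: "m = Suc m'" "n = Suc n'"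
    using less.prems(4) by (cases m; cases n) (auto simp: flips_Suc)
  let ?a = "\<lambda>i. a (Suc i)" and ?b = "\<lambda>i. b (Suc i)"
  note bin = less.prems(1,2)[unfolded bits_def, rule_format]
  consider "a 1 = b 1" "a 1 \<noteq> a 0" | "a 1 = b 1" "a 1 = a 0" | "a 1 \<noteq> b 1" by blast
  then show ?case
  proof cases
    case 1
    then have "ugt (flips ?b n') (flips ?a m')"
      using less.prems mn by (auto simp: flips_Suc split: if_splits)
    then obtain j where "\<forall>i<j. ?b i = ?a i" "?b j = 1 - ?b 0" "?a j = ?b 0"
      using less.hyps[of n' m' ?b ?a] less.prems 1 mn by (auto simp: bits_Suc)
    then show ?thesis using 1 less.prems(3) bin(1)[of 0] bin(1)[of 1]
      by (intro exI[of _ "Suc j"]) (auto simp: less_Suc_eq_0_disj)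
  next
    case 2
    then have "ugt (flips ?a m') (flips ?b n')"
      using less.prems mn by (auto simp: flips_Suc split: if_splits)
    then obtain j where "\<forall>i<j. ?a i = ?b i" "?a j = 1 - ?a 0" "?b j = ?a 0"
      using less.hyps[of m' n' ?a ?b] less.prems 2 mn by (auto simp: bits_Suc)
    then show ?thesis using 2 less.prems(3)
      by (intro exI[of _ "Suc j"]) (auto simp: less_Suc_eq_0_disj)
  next
    case 3
    then have "a 0 \<noteq> a 1" using less.prems mn by (auto simp: flips_Suc split: if_splits)
    then show ?thesis using 3 less.prems(3) bin(1)[of 0] bin(1)[of 1] bin(2)[of 1]
      by (intro exI[of _ 1]) auto
  qed
qed

lemma ugt_flips_val_less:
  assumes "bits a" "bits b" "a 0 = 0" "b 0 = 0" "ugt (flips a m) (flips b n)"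
    "\<not> (evconst a \<and> evconst b)"
  shows "val b < val a"
proof -
  obtain j where "\<forall>i<j. a i = b i" "a j = 1" "b j = 0"
    using ugt_flips[of a b m n] assms by auto
  then show ?thesis using val_less assms by blast
qed

section \<open>The periodic Thue--Morse words and their digit changes\<close>

definition tm_per :: "nat \<Rightarrow> nat \<Rightarrow> nat" where
  "tm_per k n = thue_morse (n mod 2 ^ k)"

lemma val_tm_per: "thue_morse_number k = val (tm_per k)"
  by (simp add: thue_morse_number_def val_def tm_per_def)

lemma bits_tm_per: "bits (tm_per k)"
  using thue_morse_binary by (simp add: bits_def tm_per_def)

lemma tm_per_0: "tm_per k 0 = 0"
  by (simp add: tm_per_def thue_morse_rec)

lemma tm_per_Suc:
  "tm_per (Suc k) (2 * n) = tm_per k n" "tm_per (Suc k) (Suc (2 * n)) = 1 - tm_per k n"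
proof -
  have "2 * n mod 2 ^ Suc k = 2 * (n mod 2 ^ k)" by (simp only: mult_mod_right power_Suc)
  moreover have "Suc (2 * n) mod 2 ^ Suc k = 2 * (n mod 2 ^ k) + 1"
  proof -
    have "2 * n = 2 * (n mod 2 ^ k + 2 ^ k * (n div 2 ^ k))" by (subst mod_mult_div_eq) (rule refl)
    then have "Suc (2 * n) = Suc (2 * (n mod 2 ^ k)) + 2 ^ Suc k * (n div 2 ^ k)"
      unfolding power_Suc by (simp only: add_mult_distrib2 mult.assoc add_Suc)
    then have "Suc (2 * n) mod 2 ^ Suc k = Suc (2 * (n mod 2 ^ k)) mod 2 ^ Suc k"
      by (simp only: mod_mult_self2)
    also have "\<dots> = Suc (2 * (n mod 2 ^ k))"
      using mod_less_divisor[of "2 ^ k" n] by (intro mod_less) (simp del: mod_less_divisor)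
    finally show ?thesis by simp
  qed
  ultimately show "tm_per (Suc k) (2 * n) = tm_per k n" "tm_per (Suc k) (Suc (2 * n)) = 1 - tm_per k n"
    unfolding tm_per_def using thue_morse_rec(2,3)[of "n mod 2 ^ k"] by simp_all
qed

lemma not_evconst_tm_per:
  assumes "k \<ge> 1"
  shows "\<not> evconst (tm_per k)"
proof
  assume "evconst (tm_per k)"
  then obtain N c where c: "\<And>n. n \<ge> N \<Longrightarrow> tm_per k n = c" unfolding evconst_def by blast
  obtain k' where "k = Suc k'" using assms by (cases k) auto
  then have "tm_per k' N = c" "1 - tm_per k' N = c"
    using c[of "2 * N"] c[of "Suc (2 * N)"] tm_per_Suc by auto
  then show False using bits_tm_per[of k', unfolded bits_def, rule_format, of N] by auto
qed

text \<open>Inside a block the digit always changes; between the blocks of \<open>a n\<close> and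
  \<open>a (Suc n)\<close> it changes exactly when these two agree.\<close>

lemma flips_pd:
  assumes "bits a" "\<And>n. b (2 * n) = a n" "\<And>n. b (Suc (2 * n)) = 1 - a n"
  shows "flips b (2 * n) = pd (flips a n)"
proof (induction n)
  case (Suc n)
  have "flips b (2 * Suc n) = flips b (2 * n) @ [b (2 * n) \<noteq> b (Suc (2 * n)), b (Suc (2 * n)) \<noteq> b (2 * Suc n)]"
    by (simp add: flips_def)
  also have "\<dots> = pd (flips a n) @ pd [a n \<noteq> a (Suc n)]"
    unfolding Suc assms(2,3) using assms(1)[unfolded bits_def, rule_format, of n]
      assms(1)[unfolded bits_def, rule_format, of "Suc n"] by auto
  also have "\<dots> = pd (flips a (Suc n))" by (simp add: flips_def)
  finally show ?case .
qed simp

lemma flips_tm_per: "flips (tm_per k) (2 ^ k * n) = pdword k n"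
proof (induction k)
  case 0
  have "tm_per 0 i = 0" for i by (simp add: tm_per_def thue_morse_rec)
  then show ?case by (simp add: flips_def map_replicate_const)
next
  case (Suc k)
  have "2 ^ Suc k * n = 2 * (2 ^ k * n)" by simp
  then show ?case
    unfolding pdword.simps Suc[symmetric] by (simp only: flips_pd[OF bits_tm_per tm_per_Suc])
qed

section \<open>Survivors have admissible digit changes\<close>

definition future :: "(int \<Rightarrow> nat) \<Rightarrow> int \<Rightarrow> nat \<Rightarrow> nat" where
  "future u t = (\<lambda>i. u (t + int i))"

text \<open>Past and future both start with the digit \<open>u t\<close>, since \<open>ugt\<close>
  compares expansions with a common first digit.\<close>

definition past :: "(int \<Rightarrow> nat) \<Rightarrow> int \<Rightarrow> nat \<Rightarrow> nat" where
  "past u t = (\<lambda>i. u (t - int i))"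

definition both_evconst :: "(int \<Rightarrow> nat) \<Rightarrow> bool" where
  "both_evconst u \<longleftrightarrow> evconst (future u 0) \<and> evconst (past u 0)"

lemma evconst_futureD: "evconst (future u t) \<Longrightarrow> evconst (future u s)"
proof -
  assume "evconst (future u t)"
  then obtain N c where c: "\<And>n. n \<ge> N \<Longrightarrow> u (t + int n) = c"
    unfolding evconst_def future_def by blast
  have "u (s + int n) = c" if "n \<ge> N + nat (t - s)" for n
    using c[of "nat (s - t + int n)"] that by (simp add: nat_le_iff le_nat_iff)
  then show ?thesis unfolding evconst_def future_def by blast
qed

lemma evconst_pastD: "evconst (past u t) \<Longrightarrow> evconst (past u s)"
proof -
  assume "evconst (past u t)"
  then obtain N c where c: "\<And>n. n \<ge> N \<Longrightarrow> u (t - int n) = c"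
    unfolding evconst_def past_def by blast
  have "u (s - int n) = c" if "n \<ge> N + nat (s - t)" for n
    using c[of "nat (t - s + int n)"] that by (simp add: nat_le_iff le_nat_iff)
  then show ?thesis unfolding evconst_def past_def by blast
qed

lemma evconst_compl: "bits a \<Longrightarrow> evconst (\<lambda>i. 1 - a i) \<longleftrightarrow> evconst a"
proof
  assume a: "bits a" and "evconst (\<lambda>i. 1 - a i)"
  then obtain N c where "\<And>n. n \<ge> N \<Longrightarrow> 1 - a n = c" unfolding evconst_def by blast
  moreover have "a n = 1 - (1 - a n)" for n using a[unfolded bits_def, rule_format, of n] by auto
  ultimately have "\<forall>n\<ge>N. a n = 1 - c" by metis
  then show "evconst a" unfolding evconst_def by blast
next
  assume "evconst a"
  then show "evconst (\<lambda>i. 1 - a i)" unfolding evconst_def by metis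
qed

lemma coding_shift_eq: "coding (shift (t - 1) u) = (val (future u t), val (past u (t - 1)))"
  by (simp add: coding_def shift_def val_def future_def past_def algebra_simps)

lemma val_past: "bits (past u t) \<Longrightarrow> val (past u t) = (real (u t) + val (past u (t - 1))) / 2"
  using val_split[of "past u t"] by (simp add: past_def algebra_simps)

lemma val_future: "bits (future u t) \<Longrightarrow> val (future u t) = (real (u t) + val (future u (t + 1))) / 2"
  using val_split[of "future u t"] by (simp add: future_def algebra_simps)

lemma bits_future: "u \<in> binary_seqs \<Longrightarrow> bits (future u t)"
  by (simp add: binary_seqs_def bits_def future_def)

lemma bits_past: "u \<in> binary_seqs \<Longrightarrow> bits (past u t)"
  by (simp add: binary_seqs_def bits_def past_def)

lemma trap_region_symmetric: "(x, y) \<in> trap_region k \<Longrightarrow> (1 - x, 1 - y) \<in> trap_region k"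
  by (auto simp: trap_region_def unit_square_def)

lemma flips_compl: "bits a \<Longrightarrow> flips (\<lambda>i. 1 - a i) n = flips a n"
proof -
  assume "bits a"
  then have "(1 - a i \<noteq> 1 - a (Suc i)) = (a i \<noteq> a (Suc i))" for i
    unfolding bits_def by (metis One_nat_def diff_self_eq_0 diff_zero insertE n_not_Suc_n singletonD)
  then show ?thesis by (simp add: flips_def)
qed

lemma compl_in_trap_region:
  assumes u: "u \<in> binary_seqs"
    and trap: "coding (shift (t - 1) (\<lambda>i. 1 - u i)) \<in> trap_region k"
  shows "coding (shift (t - 1) u) \<in> trap_region k"
proof -
  have "future (\<lambda>i. 1 - u i) t = (\<lambda>i. 1 - future u t i)"
    "past (\<lambda>i. 1 - u i) (t - 1) = (\<lambda>i. 1 - past u (t - 1) i)"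
    by (auto simp: future_def past_def)
  then have "coding (shift (t - 1) (\<lambda>i. 1 - u i)) = (1 - val (future u t), 1 - val (past u (t - 1)))"
    unfolding coding_shift_eq using val_compl u bits_future bits_past by metis
  then show ?thesis
    using trap_region_symmetric[of "1 - val (future u t)" "1 - val (past u (t - 1))" k] trap
    by (simp add: coding_shift_eq)
qed

text \<open>Let (x, y) be the point and \<open>u t = 0\<close>. Then \<open>val (future u t)\<close>
  is x, \<open>val (past u t)\<close> is y/2, and the three comparisons become y < 2x, 2 - 4x < y
  and t_k < x. As x \<le> 1/2, they imply the other inequalities. The case \<open>u t = 1\<close>
  follows by complementing all digits.\<close>

lemma in_trap_region:
  assumes u: "u \<in> binary_seqs" and k: "k \<ge> 1" and nc: "\<not> both_evconst u"
    and S: "flips (future u t) n = True # S" and P: "flips (past u t) m = P"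
    and gt: "ugt (True # S) P" "ugt P S" "ugt (True # S) (pdword k N)"
  shows "coding (shift (t - 1) u) \<in> trap_region k"
proof -
  have zero: "coding (shift (t - 1) u) \<in> trap_region k"
    if u: "u \<in> binary_seqs" and nc: "\<not> both_evconst u" and t: "u t = 0"
    and S: "flips (future u t) n = True # S" and P: "flips (past u t) m = P" for u
  proof -
    obtain n' where n: "n = Suc n'" using S by (cases n) auto
    have fS: "(\<lambda>i. future u t (Suc i)) = future u (t + 1)"
      by (auto simp: future_def algebra_simps)
    have S': "flips (future u (t + 1)) n' = S" "u (t + 1) \<noteq> 0"
      using S t unfolding n flips_Suc fS by (auto simp: future_def)
    moreover have "u (t + 1) \<in> {0, 1}" using u unfolding binary_seqs_def by blast
    ultimately have t1: "u (t + 1) = 1" by simp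
    have nc': "\<not> (evconst (future u t) \<and> evconst (past u t))" for t
      using nc evconst_futureD evconst_pastD unfolding both_evconst_def by blast
    have nc2: "\<not> (evconst (past u t) \<and> evconst (\<lambda>i. 1 - future u (t + 1) i))"
      using nc' evconst_futureD evconst_compl[OF bits_future[OF u]] by blast
    have 1: "val (past u t) < val (future u t)"
      using gt(1) nc' unfolding S[symmetric] P[symmetric]
      by (intro ugt_flips_val_less[of _ _ n m] bits_future bits_past u) (auto simp: t future_def past_def)
    \<comment> \<open>Since \<open>u (t + 1) = 1\<close>, the future from there is complemented to
      start with 0 like the past; its digit changes stay the same.\<close>
    have "ugt (flips (past u t) m) (flips (\<lambda>i. 1 - future u (t + 1) i) n')"
      using gt(2) unfolding flips_compl[OF bits_future[OF u]] S'(1) P .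
    then have "val (\<lambda>i. 1 - future u (t + 1) i) < val (past u t)"
      using nc2
      by (intro ugt_flips_val_less[of _ _ m n'] bits_compl bits_future bits_past u)
        (simp_all add: t t1 future_def past_def)
    then have 2: "1 - val (future u (t + 1)) < val (past u t)"
      using val_compl[OF bits_future[OF u]] by simp
    have 3: "thue_morse_number k < val (future u t)"
      unfolding val_tm_per using gt(3) not_evconst_tm_per[OF k]
      unfolding S[symmetric] flips_tm_per[symmetric]
      by (intro ugt_flips_val_less[of _ _ n "2 ^ k * N"] bits_future bits_tm_per u)
        (auto simp: t tm_per_0 future_def)
    have 4: "0 \<le> val (future u (t + 1))" "val (future u (t + 1)) \<le> 1"
      "0 \<le> val (past u (t - 1))" "val (past u (t - 1)) \<le> 1"
      using u by (simp_all add: val_nonneg val_le_1 bits_future bits_past)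
    have 5: "val (past u t) = val (past u (t - 1)) / 2" "val (future u t) = val (future u (t + 1)) / 2"
      using val_past[OF bits_past[OF u]] val_future[OF bits_future[OF u]] t by simp_all
    show ?thesis
      unfolding coding_shift_eq trap_region_def unit_square_def using 1 2 3 4 5 by auto
  qed
  show ?thesis
  proof (cases "u t = 0")
    case True
    with zero assms show ?thesis by blast
  next
    case False
    let ?u = "\<lambda>i. 1 - u i"
    have fp: "future ?u s = (\<lambda>i. 1 - future u s i)" "past ?u s = (\<lambda>i. 1 - past u s i)" for s
      by (auto simp: future_def past_def)
    have u': "?u \<in> binary_seqs" using u by (auto simp: binary_seqs_def)
    have "u t \<in> {0, 1}" using u unfolding binary_seqs_def by blast
    then have "?u t = 0" using False by simp
    moreover have "\<not> both_evconst ?u"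
      using nc evconst_compl bits_future[OF u] bits_past[OF u] unfolding both_evconst_def fp by blast
    ultimately have "coding (shift (t - 1) ?u) \<in> trap_region k"
      using S P u' bits_future[OF u] bits_past[OF u] by (intro zero) (simp_all only: fp flips_compl, simp)
    then show ?thesis by (rule compl_in_trap_region[OF u])
  qed
qed

definition window :: "(int \<Rightarrow> nat) \<Rightarrow> int \<Rightarrow> nat \<Rightarrow> bool list" where
  "window u m n = flips (future u m) n"

lemma window_split:
  assumes "window u m n = P @ S"
  shows "flips (future u (m + int (length P))) (length S) = S"
    and "flips (past u (m + int (length P))) (length P) = rev P"
proof -
  have w: "window u m n ! i = (u (m + int i) \<noteq> u (m + int i + 1))" if "i < n" for i
    using that by (simp add: window_def flips_def future_def algebra_simps)
  have n: "n = length P + length S"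
    using arg_cong[OF assms, of length] by (simp add: window_def flips_def)
  show "flips (future u (m + int (length P))) (length S) = S"
  proof (rule nth_equalityI)
    fix i assume "i < length (flips (future u (m + int (length P))) (length S))"
    then have i: "i < length S" by (simp add: flips_def)
    then have "S ! i = window u m n ! (length P + i)" unfolding assms by simp
    also have "\<dots> = flips (future u (m + int (length P))) (length S) ! i"
      using w[of "length P + i"] i n by (simp add: flips_def future_def algebra_simps)
    finally show "flips (future u (m + int (length P))) (length S) ! i = S ! i" ..
  qed (simp add: flips_def)
  show "flips (past u (m + int (length P))) (length P) = rev P"
  proof (rule nth_equalityI)
    fix i assume "i < length (flips (past u (m + int (length P))) (length P))"
    then have i: "i < length P" by (simp add: flips_def)
    then have "length P - Suc i < length P" by simp
    then have "rev P ! i = window u m n ! (length P - Suc i)"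
      unfolding assms using i by (simp only: rev_nth nth_append if_True)
    also have "\<dots> = flips (past u (m + int (length P))) (length P) ! i"
      using w[of "length P - Suc i"] i n by (auto simp: flips_def past_def of_nat_diff algebra_simps)
    finally show "flips (past u (m + int (length P))) (length P) ! i = rev P ! i" ..
  qed (simp add: flips_def)
qed

text \<open>Each pattern is split before the last \<open>True\<close> of its run. For a run of one
  or two, one of the two comparisons is decided at once and the other reduces to
  \<open>ugt (rev p) s\<close>; for a longer run both hold.\<close>

lemma survivor_admissible:
  assumes u: "u \<in> binary_seqs" "\<forall>n. coding (shift n u) \<notin> trap_region k"
    and k: "k \<ge> 1" and nc: "\<not> both_evconst u"
  shows "admissible k (window u m n)"
proof -
  have *: "low k s" if "window u m n = P @ True # False # s" "ugt (True # False # s) (rev P)"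
    "ugt (rev P) (False # s)" for P s
  proof (rule ccontr)
    assume "\<not> low k s"
    then obtain N where "ugt (True # False # s) (pdword k N)" unfolding low_def by blast
    from in_trap_region[OF u(1) k nc window_split(1)[OF that(1)] window_split(2)[OF that(1)] that(2,3) this]
    show False using u(2) by blast
  qed
  show ?thesis
    unfolding admissible_def
  proof (intro conjI allI impI)
    fix p s
    {
      assume "window u m n = p @ [False, True, False] @ s"
      then show "low k s \<or> \<not> ugt (rev p) s" using *[of "p @ [False]" s] by auto
    next
      assume "window u m n = p @ [False, True, True, False] @ s"
      then show "low k s \<or> \<not> ugt (rev p) s" using *[of "p @ [False, True]" s] by auto
    next
      assume "window u m n = p @ [True, True, True, False] @ s"
      then show "low k s" using *[of "p @ [True, True]" s] by auto
    }
  qed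
qed

section \<open>Hausdorff dimension\<close>

lemma countable_both_evconst: "countable {u. both_evconst u}"
proof (rule countable_subset)
  \<comment> \<open>\<open>l\<close> lists the digits at positions -N to N. Clamping the index
    repeats the end values outside this range, so countable data encode the sequence.\<close>
  let ?g = "\<lambda>(N :: nat, l) i. l ! nat (max (- int N) (min (int N) i) + int N)"
  show "{u. both_evconst u} \<subseteq> range ?g"
  proof (rule subsetI, drule CollectD)
    fix u assume "both_evconst u"
    then obtain M c M' d where c: "\<And>n. n \<ge> M \<Longrightarrow> u (int n) = c" and d: "\<And>n. n \<ge> M' \<Longrightarrow> u (- int n) = d"
      unfolding both_evconst_def evconst_def future_def past_def by auto
    define N where "N = max M M'"
    define l where "l = map (\<lambda>i. u (int i - int N)) [0..<2 * N + 1]"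
    have "u i = ?g (N, l) i" for i
    proof -
      define j where "j = max (- int N) (min (int N) i)"
      have j: "- int N \<le> j" "j \<le> int N" by (auto simp: j_def)
      have "nat (j + int N) < 2 * N + 1" using j by linarith
      then have "l ! nat (j + int N) = u (int (nat (j + int N)) - int N)" unfolding l_def by (simp del: upt_Suc)
      also have "int (nat (j + int N)) - int N = j" using j by simp
      finally have *: "?g (N, l) i = u j" by (simp add: j_def)
      consider "i > int N" | "i < - int N" | "j = i" unfolding j_def by linarith
      then show ?thesis
      proof cases
        case 1
        then have "j = int N" by (simp add: j_def)
        then show ?thesis using * c[of "nat i"] c[of N] 1 by (simp add: N_def)
      next
        case 2
        then have "j = - int N" by (simp add: j_def)
        then show ?thesis using * d[of "nat (- i)"] d[of N] 2 by (simp add: N_def)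
      qed (use * in simp)
    qed
    then have "u = ?g (N, l)" by (rule ext)
    then show "u \<in> range ?g" by (rule range_eqI)
  qed
qed simp

lemma window_determines:
  assumes "u \<in> binary_seqs" "v \<in> binary_seqs" "u m = v m" "window u m n = window v m n" "i \<le> n"
  shows "u (m + int i) = v (m + int i)"
  using \<open>i \<le> n\<close>
proof (induction i)
  case (Suc i)
  have "window u m n ! i = window v m n ! i" using assms(4) by simp
  then have "(u (m + int i) \<noteq> u (m + int i + 1)) = (v (m + int i) \<noteq> v (m + int i + 1))"
    using Suc by (simp add: window_def flips_def future_def algebra_simps)
  moreover have "u j = 0 \<or> u j = 1" "v j = 0 \<or> v j = 1" for j
    using assms(1,2) by (auto simp: binary_seqs_def)
  ultimately have "u (m + int i + 1) = v (m + int i + 1)" using Suc by (metis Suc_leD)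
  then show ?case by (simp add: algebra_simps)
qed (use assms in simp)

section \<open>Covers of the survivor set\<close>

text \<open>A first digit and \<open>2 * n\<close> changes fix the digits at positions 1 - n to n +
  1, which include the first \<open>n\<close> digits of both coordinates.\<close>

lemma coding_close:
  assumes u: "u \<in> binary_seqs" and v: "v \<in> binary_seqs"
    and eq: "u (1 - int n) = v (1 - int n)" "window u (1 - int n) (2 * n) = window v (1 - int n) (2 * n)"
  shows "norm (coding u - coding v) \<le> 2 * (1/2) ^ n"
proof -
  have *: "u j = v j" if "1 - int n \<le> j" "j \<le> 1 + int n" for j
    using window_determines[OF u v eq, of "nat (j + int n - 1)"] that by (simp add: nat_le_iff)
  have c: "coding w = (val (future w 1), val (past w 0))" for w
    using coding_shift_eq[of 1 w] by (simp add: shift_def)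
  have "\<bar>val (future u 1) - val (future v 1)\<bar> \<le> (1/2) ^ n"
    using u v * by (intro val_close bits_future) (auto simp: future_def)
  moreover have "\<bar>val (past u 0) - val (past v 0)\<bar> \<le> (1/2) ^ n"
    using u v * by (intro val_close bits_past) (auto simp: past_def)
  ultimately show ?thesis
    unfolding c using norm_Pair_le[of "val (future u 1) - val (future v 1)" "val (past u 0) - val (past v 0)"]
    by simp
qed

lemma card_length_le:
  fixes L :: "bool list set"
  assumes "gf_bound x B L"
  shows "real (card {w \<in> L. length w = n}) * x ^ n \<le> B"
proof -
  have "finite {w \<in> L. length w = n}"
    by (rule finite_subset[OF _ finite_lists_length_eq[of "UNIV :: bool set" n]]) auto
  then have "(\<Sum>w\<in>{w \<in> L. length w = n}. x ^ length w) \<le> B"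
    using assms unfolding gf_bound_def by blast
  then show ?thesis by simp
qed

text \<open>For \<open>s > 0\<close> singletons have weight 0, so the countable set \<open>C\<close>
  costs nothing and the sum reduces to the finitely many \<open>V k\<close>.\<close>

lemma hausdorff_premeasure_le:
  fixes s :: real
  assumes "finite K" "countable C" "0 < s" "0 \<le> r"
    and "\<And>k. k \<in> K \<Longrightarrow> bounded (V k) \<and> diameter (V k) \<le> r" "r \<le> \<delta>"
    and A: "A \<subseteq> (\<Union>k\<in>K. V k) \<union> C"
  shows "hausdorff_premeasure s \<delta> A \<le> ennreal (real (card K) * r powr s)"
proof -
  obtain h where h: "bij_betw h {0..<card K} K" using ex_bij_betw_nat_finite[OF assms(1)] by blast
  \<comment> \<open>The enumeration \<open>from_nat_into\<close> needs a nonempty set.\<close>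
  define C' where "C' = insert undefined C"
  have C': "range (from_nat_into C') = C'"
    unfolding C'_def using assms(2) by (intro range_from_nat_into) auto
  define U where "U i = (if i < card K then V (h i) else {from_nat_into C' (i - card K)})" for i
  have hK: "h i \<in> K" if "i < card K" for i using h that by (auto simp: bij_betw_def)
  have "A \<subseteq> (\<Union>i. U i)"
  proof
    fix p assume "p \<in> A"
    then consider k where "k \<in> K" "p \<in> V k" | "p \<in> C" using A by blast
    then show "p \<in> (\<Union>i. U i)"
    proof cases
      case (1 k)
      then have "k \<in> h ` {0..<card K}" using h by (simp add: bij_betw_def)
      then obtain i where "i < card K" "h i = k" by auto
      then have "p \<in> U i" using 1 by (simp add: U_def)
      then show ?thesis by blast
    next
      case 2
      then obtain j where "p = from_nat_into C' j" using C' unfolding C'_def by blast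
      then have "p \<in> U (card K + j)" by (simp add: U_def)
      then show ?thesis by blast
    qed
  qed
  moreover have "bounded (U i) \<and> diameter (U i) \<le> \<delta>" for i
    using assms(4-6) hK[of i] unfolding U_def by fastforce
  ultimately have "U \<in> delta_covers \<delta> A" unfolding delta_covers_def by blast
  then have "hausdorff_premeasure s \<delta> A \<le> (\<Sum>i. diam_weight s (U i))"
    unfolding hausdorff_premeasure_def by (rule INF_lower)
  also have "\<dots> = (\<Sum>i\<in>{..<card K}. diam_weight s (U i))"
    using assms(3) by (intro suminf_finite) (auto simp: U_def diam_weight_def)
  also have "\<dots> \<le> (\<Sum>i\<in>{..<card K}. ennreal (r powr s))"
  proof (rule sum_mono)
    fix i assume "i \<in> {..<card K}"
    then have "bounded (U i)" "diameter (U i) \<le> r" using assms(5) hK[of i] by (auto simp: U_def)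
    then have "diameter (U i) powr s \<le> r powr s"
      using assms(3) diameter_ge_0 by (intro powr_mono2) auto
    then show "diam_weight s (U i) \<le> ennreal (r powr s)"
      using assms(3) by (auto simp: diam_weight_def intro: ennreal_leI)
  qed
  also have "\<dots> = ennreal (real (card K) * r powr s)"
    by (simp add: ennreal_of_nat_eq_real_of_nat ennreal_mult'')
  finally show ?thesis .
qed

lemma hausdorff_measure_subexponential:
  fixes s :: real
  assumes L: "subexponential L" and s: "0 < s" and C: "countable C"
    and A: "A \<subseteq> coding ` {u \<in> binary_seqs. \<forall>m n. window u m n \<in> L} \<union> C"
  shows "hausdorff_measure s A = 0"
proof -
  \<comment> \<open>With this \<open>x\<close>, a set of diameter at most 2 * 2^(-n) has weight at
    most a constant times x^(4n), while the number of windows of length 2n is at most a constant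
    times x^(-2n); the product tends to 0.\<close>
  define x :: real where "x = 2 powr (- s / 4)"
  have x: "0 < x" "x < 1" using s powr_less_mono[of "- s / 4" 0 2] by (auto simp: x_def)
  obtain B where B: "gf_bound x B L" using L x unfolding subexponential_def by blast
  define q where "q = x ^ 2"
  have q: "0 < q" "q < 1" using x by (auto simp: q_def power_less_one_iff)
  have q2: "(1/2) powr s = q * q"
    by (simp add: q_def x_def power2_eq_square powr_add[symmetric] powr_divide powr_minus_divide)
  have est: "hausdorff_premeasure s \<delta> A \<le> ennreal (2 * B * 2 powr s * q ^ n)" if n: "2 * (1/2) ^ n \<le> \<delta>" for n \<delta>
  proof -
    \<comment> \<open>Digit changes determine the digits only up to complement, hence the extra
      factor \<open>{0, 1}\<close> for the first digit.\<close>
    define K where "K = {0, 1 :: nat} \<times> {w \<in> L. length w = 2 * n}"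
    define V where "V k = coding ` {u \<in> binary_seqs. u (1 - int n) = fst k \<and> window u (1 - int n) (2 * n) = snd k}" for k
    have "finite {w \<in> L. length w = 2 * n}"
      by (rule finite_subset[OF _ finite_lists_length_eq[of "UNIV :: bool set" "2 * n"]]) auto
    then have K: "finite K" "card K = 2 * card {w \<in> L. length w = 2 * n}" by (auto simp: K_def)
    have close: "norm (p - p') \<le> 2 * (1/2) ^ n" if "p \<in> V k" "p' \<in> V k" for p p' k
      using that unfolding V_def by (auto intro!: coding_close)
    have "bounded (V k) \<and> diameter (V k) \<le> 2 * (1/2) ^ n" for k
    proof
      show "diameter (V k) \<le> 2 * (1/2) ^ n" by (intro diameter_le close) auto
      show "bounded (V k)"
        unfolding bounded_def using close by (metis dist_norm)
    qed
    moreover have "A \<subseteq> (\<Union>k\<in>K. V k) \<union> C"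
    proof
      fix p assume "p \<in> A"
      then consider u where "p = coding u" "u \<in> binary_seqs" "\<And>m n. window u m n \<in> L" | "p \<in> C"
        using A by blast
      then show "p \<in> (\<Union>k\<in>K. V k) \<union> C"
      proof cases
        case (1 u)
        then have "(u (1 - int n), window u (1 - int n) (2 * n)) \<in> K"
          unfolding K_def by (auto simp: binary_seqs_def window_def flips_def)
        moreover have "p \<in> V (u (1 - int n), window u (1 - int n) (2 * n))"
          using 1 unfolding V_def by auto
        ultimately show ?thesis by blast
      qed simp
    qed
    ultimately have "hausdorff_premeasure s \<delta> A \<le> ennreal (real (card K) * (2 * (1/2) ^ n) powr s)"
      using hausdorff_premeasure_le[OF K(1) C s, of "2 * (1/2) ^ n" V \<delta> A] n by simp
    also have "real (card K) * (2 * (1/2) ^ n) powr s \<le> 2 * B * 2 powr s * q ^ n"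
    proof -
      have "(2 * (1/2) ^ n) powr s = 2 powr s * ((1/2) powr s) ^ n"
        by (simp add: powr_mult powr_realpow[symmetric] powr_powr mult.commute)
      also have "\<dots> = 2 powr s * (q ^ n * q ^ n)" by (simp add: q2 power_mult_distrib)
      finally have "real (card K) * (2 * (1/2) ^ n) powr s
          = 2 * (real (card {w \<in> L. length w = 2 * n}) * x ^ (2 * n)) * 2 powr s * q ^ n"
        by (simp add: K q_def power_mult)
      also have "\<dots> \<le> 2 * B * 2 powr s * q ^ n"
        using card_length_le[OF B, of "2 * n"] q by (intro mult_right_mono mult_left_mono) auto
      finally show ?thesis .
    qed
    finally show ?thesis by (simp add: ennreal_leI)
  qed
  have "hausdorff_premeasure s \<delta> A = 0" if "0 < \<delta>" for \<delta>
  proof -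
    have "(\<lambda>n. 2 * (1/2) ^ n :: real) \<longlonglongrightarrow> 2 * 0"
      by (intro tendsto_intros LIMSEQ_power_zero) auto
    then have "\<forall>\<^sub>F n in sequentially. 2 * (1/2) ^ n < \<delta>"
      using that by (intro order_tendstoD) auto
    then have ev: "\<forall>\<^sub>F n in sequentially. hausdorff_premeasure s \<delta> A \<le> ennreal (2 * B * 2 powr s * q ^ n)"
      by (rule eventually_mono) (rule est, simp)
    have "(\<lambda>n. 2 * B * 2 powr s * q ^ n) \<longlonglongrightarrow> 2 * B * 2 powr s * 0"
      using q by (intro tendsto_intros LIMSEQ_power_zero) auto
    then have "(\<lambda>n. ennreal (2 * B * 2 powr s * q ^ n)) \<longlonglongrightarrow> ennreal 0"
      by (intro tendsto_ennrealI) simp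
    then have "hausdorff_premeasure s \<delta> A \<le> ennreal 0"
      by (rule tendsto_lowerbound[OF _ ev]) simp
    then show ?thesis by simp
  qed
  then show ?thesis unfolding hausdorff_measure_def by (auto simp: SUP_eq_const)
qed

lemma openin_trap_region: "openin (top_of_set unit_square) (trap_region k)"
proof -
  let ?T = "{p :: real \<times> real. 2 * fst p - 1 < snd p \<and> snd p < 2 * fst p \<and>
        2 - 4 * fst p < snd p \<and> snd p < 3 - 4 * fst p \<and>
        thue_morse_number k < fst p \<and> fst p < 1 - thue_morse_number k}"
  have "open ?T" by (intro open_Collect_conj open_Collect_less continuous_intros)
  moreover have "trap_region k = unit_square \<inter> ?T" by (auto simp: trap_region_def)
  ultimately show ?thesis by (auto simp: openin_open)
qed

theorem proposition4p9:
  fixes k :: nat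
  assumes "k \<ge> 1"
  shows "dimension_trap (trap_region k)"
proof -
  let ?L = "{w. admissible k w}"
  \<comment> \<open>Sequences with both ends eventually constant, where equal values could spoil
    strict comparisons, are countably many and go into the exceptional set.\<close>
  have "survivor_set (trap_region k) \<subseteq> coding ` {u \<in> binary_seqs. \<forall>m n. window u m n \<in> ?L} \<union>
      coding ` {u. both_evconst u}"
    unfolding survivor_set_def using survivor_admissible[OF _ _ assms] by blast
  then have "hausdorff_measure s (survivor_set (trap_region k)) = 0" if "0 < s" for s
    using that by (intro hausdorff_measure_subexponential[OF subexponential_admissible])
      (auto intro: countable_both_evconst)
  then have le: "hausdorff_dim (survivor_set (trap_region k)) \<le> ennreal s" if "0 < s" for s
    unfolding hausdorff_dim_def using that by (intro Inf_lower) auto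
  have "hausdorff_dim (survivor_set (trap_region k)) \<le> 0 + ennreal s" if "0 < s" for s
    using le[OF that] by simp
  then have "hausdorff_dim (survivor_set (trap_region k)) \<le> 0"
    by (rule ennreal_le_epsilon)
  then show ?thesis unfolding dimension_trap_def using openin_trap_region by simp
qed

end
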